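(* Let $0<a<b<\infty$ and $0\le c<1$ be fixed real numbers, and let $r:\mathbb{R}^2\to[a,b]$ be a $C^2$ function such that $|\nabla r|\le c$ on $\mathbb{R}^2$. Let $E\subset\mathbb{R}^2$ be a purely unrectifiable self-similar $1$-set with $n$-th approximations $E_n$, as defined in the context. Then $$\bigcup_{x\in E}C(x,r(x))$$ has 2-dimensional Lebesgue measure zero. Furthermore, there is a constant $C$ independent of $n$ such that for all $n$ $$\left|\bigcup_{x\in E_n}C(x,r(x))\right|\le C\,\mathrm{Fav}(E_{\lfloor n/2\rfloor}).$$
   Context: $C(x,\rho)=\{y\in\mathbb{R}^2:|x-y|=\rho\}$ is the circle with center $x$ and radius $\rho$. $|\cdot|$ of a set denotes Lebesgue measure of the appropriate dimension. Self-similar set: let $L\in\mathbb{N}$, $L\ge 3$, let $b_1,\dots,b_L\in\mathbb{R}^2$ be not all collinear, and let $\Lambda_i(x)=L^{-1}x+b_i$. $E\subset\mathbb{R}^2$ is the unique non-empty compact set with $E=\bigcup_{i=1}^L\Lambda_i(E)$. It is assumed that the Strong Separation Condition holds: $\Lambda_i(E)\cap\Lambda_j(E)=\emptyset$ for $i\ne j$. (Such an $E$ has Hausdorff dimension 1 and is purely unrectifiable.) The approximations are $E_0=[0,1]^2$, $E_n=\bigcup_{i=1}^L\Lambda_i(E_{n-1})$ for $n\ge1$. $\mathrm{Fav}(F)=\int_0^\pi|\pi_\theta(F)|\,d\theta$ with $\pi_\theta(x)=x_1\cos\theta+x_2\sin\theta$. *)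

theory Defs
  imports "HOL-Analysis.Analysis"
begin

definition contr :: "nat \<Rightarrow> (nat \<Rightarrow> real^2) \<Rightarrow> nat \<Rightarrow> real^2 \<Rightarrow> real^2" where
  "contr L b i x = (1 / real L) *\<^sub>R x + b i"

primrec level_approx :: "nat \<Rightarrow> (nat \<Rightarrow> real^2) \<Rightarrow> nat \<Rightarrow> (real^2) set" where
  "level_approx L b 0 = cbox 0 1"
| "level_approx L b (Suc n) = (\<Union>i\<in>{1..L}. contr L b i ` level_approx L b n)"

definition proj :: "real \<Rightarrow> real^2 \<Rightarrow> real" where
  "proj \<theta> x = x$1 * cos \<theta> + x$2 * sin \<theta>"

definition Fav :: "(real^2) set \<Rightarrow> ennreal" where
  "Fav F = (\<integral>\<^sup>+\<theta>\<in>{0..pi}. emeasure lebesgue (proj \<theta> ` F) \<partial>lborel)"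

text \<open>Twice Frechet differentiable on the whole plane, with the second derivative continuous in
  the operator norm.\<close>

definition C2 :: "(real^2 \<Rightarrow> real) \<Rightarrow> bool" where
  "C2 f \<longleftrightarrow>
     (\<exists>(f' :: real^2 \<Rightarrow> ((real^2) \<Rightarrow>\<^sub>L real)) (f'' :: real^2 \<Rightarrow> ((real^2) \<Rightarrow>\<^sub>L ((real^2) \<Rightarrow>\<^sub>L real))).
        (\<forall>x. (f has_derivative blinfun_apply (f' x)) (at x)) \<and>
        (\<forall>x. (f' has_derivative blinfun_apply (f'' x)) (at x)) \<and>
        continuous_on UNIV f'')"

text \<open>The sets measured below are compact, so that the value 0 which \<^const>\<open>emeasure\<close> gives to
  non-measurable sets plays no role.\<close>

lemma compact_level_approx: "compact (level_approx L b n)"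
proof (induction n)
  case (Suc n)
  have "compact (contr L b i ` level_approx L b n)" for i
    unfolding contr_def using Suc by (intro compact_continuous_image continuous_intros)
  then show ?case by auto
qed simp

lemma compact_proj_image:
  assumes "compact F" shows "compact (proj \<theta> ` F)"
  unfolding proj_def using assms by (intro compact_continuous_image continuous_intros)

lemma compact_Union_sphere:
  fixes r :: "real^2 \<Rightarrow> real"
  assumes "compact F" "continuous_on F r" and pos: "\<And>x. x \<in> F \<Longrightarrow> 0 < r x"
  shows "compact (\<Union>x\<in>F. sphere x (r x))"
proof -
  have "(\<Union>x\<in>F. sphere x (r x)) = (\<lambda>p. fst p + r (fst p) *\<^sub>R snd p) ` (F \<times> sphere 0 1)"
  proof (intro equalityI subsetI)
    fix y assume "y \<in> (\<Union>x\<in>F. sphere x (r x))"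
    then obtain x where x: "x \<in> F" "norm (y - x) = r x"
      by (auto simp: dist_norm norm_minus_commute)
    then have "y = x + r x *\<^sub>R ((1 / r x) *\<^sub>R (y - x))" "norm ((1 / r x) *\<^sub>R (y - x)) = 1"
      using pos[of x] by auto
    then show "y \<in> (\<lambda>p. fst p + r (fst p) *\<^sub>R snd p) ` (F \<times> sphere 0 1)"
      using x by (intro image_eqI[of _ _ "(x, (1 / r x) *\<^sub>R (y - x))"]) auto
  next
    fix y assume "y \<in> (\<lambda>p. fst p + r (fst p) *\<^sub>R snd p) ` (F \<times> sphere 0 1)"
    then obtain x u where xu: "x \<in> F" "norm u = 1" "y = x + r x *\<^sub>R u" by auto
    then show "y \<in> (\<Union>x\<in>F. sphere x (r x))"
      using pos[of x] by (intro UN_I[of x]) (auto simp: dist_norm)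
  qed
  moreover have "continuous_on (F \<times> sphere 0 1) (\<lambda>p. fst p + r (fst p) *\<^sub>R snd p)"
    by (intro continuous_intros continuous_on_compose2[OF assms(2)]) auto
  ultimately show ?thesis
    using assms(1) by (simp add: compact_continuous_image compact_Times)
qed

end

theory Submission
  imports Defs
begin

text \<open>Let \<open>\<delta> = L\<^sup>-\<^sup>m\<close> with \<open>m = \<lfloor>n/2\<rfloor>\<close>. Seen from a cell of level \<open>m\<close> with corner \<open>x\<close>, the circle centred at
  \<open>x + \<delta>h\<close> is, near \<open>x + r(x)u\<close> and up to \<open>O(\<delta>\<^sup>2)\<close>, the line orthogonal to \<open>u\<close> displaced by
  \<open>\<delta> (u + \<nabla>r(x)) \<bullet> h\<close>. The circles of one cell therefore fill at most \<open>O(\<delta>)\<close> times the integral over the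
  directions of \<open>u + \<nabla>r(x)\<close> of the projections of \<open>E\<^sub>m\<close>, and there are \<open>1/\<delta>\<close> cells; \<open>|\<nabla>r| \<le> c < 1\<close> makes
  \<open>u \<mapsto> u + \<nabla>r(x)\<close> bi-Lipschitz in direction.

  For the null set, start the construction from a large disc instead of the unit square, so that the
  approximations decrease to \<open>E\<close> and their Favard lengths to that of \<open>E\<close>. A projection of \<open>E\<close> of positive
  measure keeps the projected corners of the level-\<open>m\<close> pieces at distance \<open>\<ge> \<epsilon> L\<^sup>-\<^sup>m\<close>, but every direction has at every
  scale a proportionally close direction in which two pieces coincide. The exceptional directions form
  a countable union of porous sets.\<close>

section \<open>Planar geometry\<close>

text \<open>The halving of n is dictated by the linearization. Rescaled to unit size, a cell of
  level m sees its circles with an error of order \<open>mesh m\<close>, so detail finer than level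
  m inside the cell is lost. The loss is harmless because the comparison set
  \<open>E\<^sub>m\<close> has cells of just that width: thickening a union of segments by a
  multiple of their length costs only a constant factor. Within a sector of directions the area
  bound holds for every direction at once, so it may be averaged over the sector, and the averages
  add up to the Favard length. The estimate is proved for a general convex starting set, since
  levels built on the unit square need neither decrease nor contain E.\<close>

definition dir :: "real \<Rightarrow> real^2" where
  "dir \<theta> = vector [cos \<theta>, sin \<theta>]"

lemma proj_eq_inner: "proj \<theta> x = dir \<theta> \<bullet> x"
  by (simp add: proj_def dir_def inner_vec_def sum_2 mult.commute)

lemma inner_2: "(x::real^2) \<bullet> y = x$1 * y$1 + x$2 * y$2"
  by (simp add: inner_vec_def sum_2)

lemma norm_2_sq: "norm (x::real^2) ^ 2 = (x$1)\<^sup>2 + (x$2)\<^sup>2"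
  unfolding power2_norm_eq_inner inner_2 by (simp add: power2_eq_square)

lemma norm_dir [simp]: "norm (dir \<theta>) = 1"
  using norm_2_sq[of "dir \<theta>"] by (simp add: dir_def abs_square_eq_1 power2_eq_1_iff)

lemma proj_add: "proj \<theta> (x + y) = proj \<theta> x + proj \<theta> y"
  by (simp add: proj_eq_inner inner_add_right)

lemma proj_scale: "proj \<theta> (a *\<^sub>R x) = a * proj \<theta> x"
  by (simp add: proj_eq_inner)

lemma proj_diff: "proj \<theta> (x - y) = proj \<theta> x - proj \<theta> y"
  by (simp add: proj_eq_inner inner_diff_right)

lemma abs_proj_le: "\<bar>proj \<theta> x\<bar> \<le> norm x"
  using Cauchy_Schwarz_ineq2[of "dir \<theta>" x] by (simp add: proj_eq_inner)

text \<open>The chord has length \<open>2 * \<bar>sin ((\<theta> - \<phi>) / 2)\<bar>\<close>, which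
  is at most the arc.\<close>

lemma dir_diff_le: "norm (dir \<theta> - dir \<phi>) \<le> \<bar>\<theta> - \<phi>\<bar>"
proof (rule power2_le_imp_le)
  have "norm (dir \<theta> - dir \<phi>) ^ 2 = 2 - 2 * cos (\<theta> - \<phi>)"
    unfolding norm_2_sq
    using sin_cos_squared_add[of \<theta>] sin_cos_squared_add[of \<phi>]
    by (simp add: dir_def power2_diff cos_diff del: sin_cos_squared_add sin_cos_squared_add2)
  also have "\<dots> = 4 * (sin ((\<theta> - \<phi>) / 2))\<^sup>2"
    using cos_double_sin[of "(\<theta> - \<phi>) / 2"] by (simp only: field_sum_of_halves mult_2)
  also have "\<dots> \<le> 4 * ((\<theta> - \<phi>) / 2)\<^sup>2"
    using abs_sin_x_le_abs_x[of "(\<theta> - \<phi>) / 2"] by (intro mult_left_mono) (auto simp: abs_le_square_iff[symmetric])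
  finally show "norm (dir \<theta> - dir \<phi>) ^ 2 \<le> \<bar>\<theta> - \<phi>\<bar>\<^sup>2"
    by (simp add: power_divide)
qed auto

text \<open>\<open>Fav\<close> integrates over half of the circle only, so the remaining unit
  vectors are reached through the sign \<open>s\<close>, which accompanies the direction in the
  estimates for circles.\<close>

lemma unit_eq_dir_upto_sign:
  assumes "norm (v::real^2) = 1"
  obtains s \<theta> where "s = 1 \<or> s = -1" "0 \<le> \<theta>" "\<theta> \<le> pi" "v = s *\<^sub>R dir \<theta>"
proof -
  have *: "(v$1)\<^sup>2 + (v$2)\<^sup>2 = 1" using norm_2_sq[of v] assms by simp
  show ?thesis
  proof (cases "0 \<le> v$2")
    case True
    then obtain t where "0 \<le> t" "t \<le> pi" "v$1 = cos t" "v$2 = sin t"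
      using sincos_total_pi * by blast
    then show ?thesis using that[of 1 t] by (simp add: vec_eq_iff forall_2 dir_def)
  next
    case False
    then obtain t where "0 \<le> t" "t \<le> pi" "- v$1 = cos t" "- v$2 = sin t"
      using sincos_total_pi[of "- v$2" "- v$1"] * by auto
    then show ?thesis using that[of "-1" t] by (simp add: vec_eq_iff forall_2 dir_def)
  qed
qed

text \<open>The translates of \<open>A\<close> by multiples of \<open>d\<close> cover the neighbourhood, because each point of \<open>A\<close>
  is the endpoint of a segment of length \<open>d\<close> in \<open>A\<close>.\<close>

lemma emeasure_thickening_le:
  fixes A B :: "real set"
  assumes A: "A \<in> sets lebesgue" and d: "0 < d"
    and seg: "\<And>x. x \<in> A \<Longrightarrow> \<exists>y\<in>A. d \<le> \<bar>y - x\<bar> \<and> closed_segment x y \<subseteq> A"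
    and B: "B \<subseteq> {x. \<exists>a\<in>A. \<bar>x - a\<bar> \<le> real M * d}"
  shows "emeasure lebesgue B \<le> ennreal (2 * real M + 1) * emeasure lebesgue A"
proof -
  let ?I = "{- int M..int M}"
  let ?T = "\<lambda>i::int. (+) (of_int i * d) ` A"
  have "B \<subseteq> (\<Union>i\<in>?I. ?T i)"
  proof
    fix x assume "x \<in> B"
    then obtain a where a: "a \<in> A" "\<bar>x - a\<bar> \<le> real M * d" using B by auto
    obtain y where y: "y \<in> A" "d \<le> \<bar>y - a\<bar>" "closed_segment a y \<subseteq> A" using seg a by blast
    \<comment> \<open>The displacement is measured in units of \<open>d\<close>. Rounding down
      leaves a remainder in [0, d], rounding up one in [-d, 0]; the choice follows the side on which
      the segment at \<open>a\<close> extends.\<close>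
    define q where "q = (x - a) / d"
    have q: "x - a = q * d" "\<bar>q\<bar> \<le> real M" using a d by (auto simp: q_def field_simps abs_if split: if_splits)
    show "x \<in> (\<Union>i\<in>?I. ?T i)"
    proof (cases "a \<le> y")
      case True
      have "a + (q - of_int \<lfloor>q\<rfloor>) * d \<in> closed_segment a y"
      proof -
        have "0 \<le> (q - of_int \<lfloor>q\<rfloor>) * d" "(q - of_int \<lfloor>q\<rfloor>) * d \<le> 1 * d"
          using d by (auto intro!: mult_nonneg_nonneg mult_right_mono simp del: mult_1) linarith+
        then show ?thesis using True y by (auto simp: closed_segment_eq_real_ivl)
      qed
      then have "x \<in> ?T \<lfloor>q\<rfloor>" using y(3) q by (auto simp: image_iff algebra_simps intro!: bexI[of _ "a + (q - of_int \<lfloor>q\<rfloor>) * d"])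
      moreover have "\<lfloor>q\<rfloor> \<in> ?I" using q(2) by (auto simp: abs_le_iff le_floor_iff) linarith+
      ultimately show ?thesis by blast
    next
      case False
      have "a + (q - of_int \<lceil>q\<rceil>) * d \<in> closed_segment a y"
      proof -
        have "(q - of_int \<lceil>q\<rceil>) * d \<le> 0" "-1 * d \<le> (q - of_int \<lceil>q\<rceil>) * d"
          using d by (intro mult_nonpos_nonneg mult_right_mono; linarith)+
        then show ?thesis using False y by (auto simp: closed_segment_eq_real_ivl)
      qed
      then have "x \<in> ?T \<lceil>q\<rceil>" using y(3) q by (auto simp: image_iff algebra_simps intro!: bexI[of _ "a + (q - of_int \<lceil>q\<rceil>) * d"])
      moreover have "\<lceil>q\<rceil> \<in> ?I" using q(2) by (auto simp: abs_le_iff ceiling_le_iff) linarith+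
      ultimately show ?thesis by blast
    qed
  qed
  moreover have T: "?T i \<in> sets lebesgue" for i
    using A lebesgue_sets_translation by blast
  ultimately have "emeasure lebesgue B \<le> emeasure lebesgue (\<Union>i\<in>?I. ?T i)"
    by (intro emeasure_mono) auto
  also have "\<dots> \<le> (\<Sum>i\<in>?I. emeasure lebesgue (?T i))"
    using T by (intro emeasure_subadditive_finite) auto
  also have "\<dots> = (\<Sum>i\<in>?I. emeasure lebesgue A)"
  proof (intro sum.cong refl)
    fix i
    have "?T i = (\<lambda>x. 1 *\<^sub>R x + of_int i * d) ` A" by (intro image_cong) auto
    then show "emeasure lebesgue (?T i) = emeasure lebesgue A"
      using emeasure_lebesgue_affine[of 1 "of_int i * d" A] by simp
  qed
  also have "\<dots> = ennreal (2 * real M + 1) * emeasure lebesgue A"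
    by (simp add: ennreal_of_nat_eq_real_of_nat algebra_simps)
  finally show ?thesis .
qed

section \<open>Area of planar slabs\<close>

lemma continuous_on_vec2: "continuous_on UNIV (\<lambda>p::real\<times>real. vector [fst p, snd p] :: real^2)"
  by (subst continuous_on_componentwise) (auto simp: Basis_vec_def inner_axis forall_2 UNIV_2 intro!: continuous_intros)

text \<open>Allows a set in \<open>real^2\<close> given by separate conditions on the two
  coordinates to be measured as a product.\<close>

lemma lborel_vec2: "lborel = distr (lborel :: (real \<times> real) measure) borel (\<lambda>p. vector [fst p, snd p] :: real^2)"
proof (rule lborel_eqI)
  have ms: "(\<lambda>p::real\<times>real. vector [fst p, snd p] :: real^2) \<in> borel_measurable lborel"
    using borel_measurable_continuous_onI[OF continuous_on_vec2] by simp
  fix l u :: "real^2"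
  assume lu: "\<And>c. c \<in> Basis \<Longrightarrow> l \<bullet> c \<le> u \<bullet> c"
  have le: "l$1 \<le> u$1" "l$2 \<le> u$2" using lu[of "axis 1 1"] lu[of "axis 2 1"] by (auto simp: inner_axis axis_in_Basis_iff)
  have "(\<lambda>p. vector [fst p, snd p] :: real^2) -` box l u = box (l$1, l$2) (u$1, u$2)"
    unfolding box_def[of "(l$1, l$2)"] Basis_prod_def by (auto simp: mem_box_cart forall_2)
  then have "emeasure (distr lborel borel (\<lambda>p. vector [fst p, snd p] :: real^2)) (box l u)
      = emeasure lborel (box (l$1, l$2) (u$1, u$2))"
    by (subst emeasure_distr[OF ms]) auto
  also have "\<dots> = ennreal (\<Prod>c\<in>Basis. (u - l) \<bullet> c)"
    using le by (subst emeasure_lborel_box) (auto simp: Basis_prod_def Basis_vec_def UNIV_2 inner_axis axis_eq_axis prod.union_disjoint)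
  finally show "emeasure (distr lborel borel (\<lambda>p. vector [fst p, snd p] :: real^2)) (box l u) = ennreal (\<Prod>c\<in>Basis. (u - l) \<bullet> c)" .
qed simp

text \<open>In the orthonormal frame formed by \<open>u\<close> and its quarter turn, the first
  coordinate of \<open>y - p\<close> lies in \<open>T\<close> and the second between
  \<open>-\<rho>\<close> and \<open>\<rho>\<close>; rotations and translations preserve the area of
  the product.\<close>

lemma emeasure_slab_le:
  fixes p u :: "real^2"
  assumes u: "norm u = 1" and T: "compact T" and \<rho>: "0 \<le> \<rho>"
  shows "emeasure lebesgue {y. norm (y - p) \<le> \<rho> \<and> u \<bullet> (y - p) \<in> T}
    \<le> ennreal (2 * \<rho>) * emeasure lebesgue T"
proof -
  define rot :: "real^2 \<Rightarrow> real^2" where "rot z = (z$1) *\<^sub>R u + (z$2) *\<^sub>R vector [- (u$2), u$1]" for z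
  have uu: "(u$1)\<^sup>2 + (u$2)\<^sup>2 = 1" using norm_2_sq[of u] u by simp
  have lin: "linear rot" unfolding rot_def by (rule linearI) (simp_all add: algebra_simps)
  have rr: "rot v \<bullet> rot w = v \<bullet> w" for v w
  proof -
    have "rot v \<bullet> rot w = (v$1 * w$1 + v$2 * w$2) * ((u$1)\<^sup>2 + (u$2)\<^sup>2)"
      by (simp add: rot_def inner_2 algebra_simps power2_eq_square)
    then show ?thesis using uu by (simp add: inner_2)
  qed
  have orth: "orthogonal_transformation rot" using lin rr by (simp add: orthogonal_transformation_def)
  define V :: "(real^2) set" where "V = {z. z$1 \<in> T \<and> z$2 \<in> {-\<rho>..\<rho>}}"
  have Vim: "V = (\<lambda>p. vector [fst p, snd p]) ` (T \<times> {-\<rho>..\<rho>})"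
  proof (intro equalityI subsetI)
    fix z assume "z \<in> V"
    then show "z \<in> (\<lambda>p. vector [fst p, snd p]) ` (T \<times> {-\<rho>..\<rho>})"
      by (intro image_eqI[of _ _ "(z$1, z$2)"]) (auto simp: V_def vec_eq_iff forall_2)
  qed (auto simp: V_def)
  have Vc: "compact V" unfolding Vim
    by (intro compact_continuous_image continuous_on_subset[OF continuous_on_vec2] compact_Times T) auto
  have "emeasure lebesgue V = emeasure lborel V" using Vc by (simp add: compact_imp_closed)
  also have "\<dots> = emeasure lborel (T \<times> {-\<rho>..\<rho>})"
    apply (subst lborel_vec2, subst emeasure_distr)
    using borel_measurable_continuous_onI[OF continuous_on_vec2] Vc
    by (auto intro!: arg_cong[of _ _ "emeasure lborel"] simp: V_def compact_imp_closed)
  also have "\<dots> = emeasure lborel T * ennreal (2 * \<rho>)"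
    using T \<rho> by (subst lborel_prod[symmetric], subst lborel.emeasure_pair_measure_Times) (auto simp: compact_imp_closed)
  also have "\<dots> = ennreal (2 * \<rho>) * emeasure lebesgue T" using T by (simp add: compact_imp_closed mult.commute)
  finally have eV: "emeasure lebesgue V = ennreal (2 * \<rho>) * emeasure lebesgue T" .
  have VL: "V \<in> lmeasurable" using Vc lmeasurable_compact by blast
  have rotV: "rot ` V \<in> lmeasurable" "measure lebesgue (rot ` V) = measure lebesgue V"
    using measurable_orthogonal_image[OF orth VL] measure_orthogonal_image[OF orth VL] by auto
  have eR: "emeasure lebesgue ((+) p ` rot ` V) = emeasure lebesgue V"
    using emeasure_lebesgue_affine[of 1 p "rot ` V"] rotV VL
    by (simp add: emeasure_eq_measure2 add.commute)
  have "{y. norm (y - p) \<le> \<rho> \<and> u \<bullet> (y - p) \<in> T} \<subseteq> (+) p ` rot ` V"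
  proof
    fix y assume "y \<in> {y. norm (y - p) \<le> \<rho> \<and> u \<bullet> (y - p) \<in> T}"
    then have y: "norm (y - p) \<le> \<rho>" "u \<bullet> (y - p) \<in> T" by auto
    define z where "z = y - p"
    have "rot (vector [u \<bullet> z, vector [- (u$2), u$1] \<bullet> z]) = ((u$1)\<^sup>2 + (u$2)\<^sup>2) *\<^sub>R z"
      by (simp add: rot_def inner_2 vec_eq_iff forall_2 algebra_simps power2_eq_square)
    then have e: "rot (vector [u \<bullet> z, vector [- (u$2), u$1] \<bullet> z]) = z" using uu by simp
    have "norm (vector [- (u$2), u$1] :: real^2) = 1"
      using norm_2_sq[of "vector [- (u$2), u$1] :: real^2"] uu by (simp add: add.commute) (smt (verit) norm_ge_zero power2_eq_1_iff)
    then have "\<bar>vector [- (u$2), u$1] \<bullet> z\<bar> \<le> norm z"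
      using Cauchy_Schwarz_ineq2[of "vector [- (u$2), u$1]" z] by simp
    then have "vector [u \<bullet> z, vector [- (u$2), u$1] \<bullet> z] \<in> V" using y by (auto simp: V_def z_def)
    then have "z \<in> rot ` V" using e by (metis imageI)
    then show "y \<in> (+) p ` rot ` V" by (auto simp: z_def image_image image_iff algebra_simps)
  qed
  then have "emeasure lebesgue {y. norm (y - p) \<le> \<rho> \<and> u \<bullet> (y - p) \<in> T} \<le> emeasure lebesgue ((+) p ` rot ` V)"
    using rotV lebesgue_sets_translation by (intro emeasure_mono) (auto simp: fmeasurableD)
  then show ?thesis using eR eV by simp
qed

text \<open>The squares of the two quantities differ by
  \<open>norm q ^ 2 - (u \<bullet> q)\<^sup>2\<close>, and their sum is at least \<open>a\<close>
  when \<open>q\<close> is short. For \<open>norm q \<ge> a / 2\<close> the triangle inequality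
  suffices; this case produces the factor 4.\<close>

lemma norm_radial_approx:
  fixes u q :: "'a::real_inner"
  assumes u: "norm u = 1" and a: "0 < a" "a \<le> r"
  shows "\<bar>norm (r *\<^sub>R u + q) - (r + u \<bullet> q)\<bar> \<le> 4 * norm q ^ 2 / a"
proof -
  let ?N = "norm (r *\<^sub>R u + q)"
  have uq: "\<bar>u \<bullet> q\<bar> \<le> norm q" using Cauchy_Schwarz_ineq2[of u q] u by simp
  have N2: "?N ^ 2 = r\<^sup>2 + 2 * r * (u \<bullet> q) + norm q ^ 2"
    unfolding power2_norm_eq_inner
    using u by (simp add: inner_simps norm_eq_1 inner_commute power2_eq_square algebra_simps)
  have "u \<bullet> (r *\<^sub>R u + q) = r + u \<bullet> q" using u by (simp add: inner_simps norm_eq_1)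
  then have ge: "r + u \<bullet> q \<le> ?N" using norm_cauchy_schwarz[of u "r *\<^sub>R u + q"] u by simp
  have "?N - (r + u \<bullet> q) \<le> 4 * norm q ^ 2 / a"
  proof (cases "norm q \<ge> a / 2")
    case True
    have "?N \<le> r + norm q" using norm_triangle_ineq[of "r *\<^sub>R u" q] u a by simp
    then have "?N - (r + u \<bullet> q) \<le> 2 * norm q" using uq by linarith
    also have "\<dots> \<le> 2 * norm q * (norm q / (a / 2))"
      using True a mult_left_mono[of 1 "norm q / (a / 2)" "2 * norm q"] by simp
    finally show ?thesis by (simp add: power2_eq_square)
  next
    case False
    have "?N + (r + u \<bullet> q) \<ge> a" using ge uq a False by linarith
    then have "(?N - (r + u \<bullet> q)) * a \<le> (?N - (r + u \<bullet> q)) * (?N + (r + u \<bullet> q))"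
      using ge by (intro mult_left_mono) auto
    also have "\<dots> = norm q ^ 2 - (u \<bullet> q)\<^sup>2"
      using N2 by (simp add: algebra_simps power2_eq_square)
    also have "\<dots> \<le> 4 * norm q ^ 2" by (smt (verit) zero_le_power2)
    finally show ?thesis using a by (simp add: pos_le_divide_eq)
  qed
  then show ?thesis using ge by simp
qed

text \<open>The ray from \<open>- g\<close>, a point inside the unit circle, in direction
  \<open>e\<close> leaves the disc at \<open>u\<close>. Because \<open>norm g \<le> c < 1\<close>,
  it crosses the circle at an angle bounded away from tangency, so the exit point depends on
  \<open>e\<close> in a Lipschitz way.\<close>

lemma unit_shift_lipschitz:
  fixes u u' e e' g :: "'a::real_inner"
  assumes c: "0 \<le> c" "c < 1" and g: "norm g \<le> c" and u: "norm u = 1" "norm u' = 1"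
    and e: "norm e = 1" "norm e' = 1" and t: "0 \<le> t" "0 \<le> t'"
    and v: "u + g = t *\<^sub>R e" "u' + g = t' *\<^sub>R e'"
  shows "norm (u - u') \<le> 6 * (1 + c) / (1 - c) * norm (e - e')"
proof -
  \<comment> \<open>A lower bound for \<open>e \<bullet> u\<close>, the cosine of the angle between
    ray and radius: \<open>t * (e \<bullet> u) = 1 + g \<bullet> u\<close> is at least
    \<open>1 - c\<close>, and \<open>t\<close> is at most \<open>1 + c\<close>.\<close>
  define \<kappa> where "\<kappa> = (1 - c) / (1 + c)"
  have \<kappa>: "0 < \<kappa>" "\<kappa> \<le> 1" using c by (auto simp: \<kappa>_def field_simps)
  have tn: "t = norm (u + g)" "t' = norm (u' + g)" using v e t by auto
  have tb: "t \<le> 1 + c" "1 - c \<le> t" "t' \<le> 1 + c" "1 - c \<le> t'"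
    unfolding tn using norm_triangle_ineq[of u g] norm_triangle_ineq[of u' g] norm_diff_ineq[of u g] norm_diff_ineq[of u' g] u g by auto
  have eu: "\<kappa> \<le> e \<bullet> u" if "norm e = 1" "norm u = 1" "u + g = t *\<^sub>R e" "t \<le> 1 + c" "1 - c \<le> t" for e u t
  proof -
    have "t * (e \<bullet> u) = (u + g) \<bullet> u" using that by simp
    also have "\<dots> = 1 + g \<bullet> u" using that(2) by (simp add: inner_simps norm_eq_1)
    finally have "1 - c \<le> t * (e \<bullet> u)" using Cauchy_Schwarz_ineq2[of g u] that(2) g by simp
    moreover then have "0 \<le> e \<bullet> u" using that c by (smt (verit) mult_nonneg_nonpos)
    ultimately have "1 - c \<le> (1 + c) * (e \<bullet> u)" using that by (smt (verit) mult_right_mono)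
    then show ?thesis using c by (simp add: \<kappa>_def field_simps)
  qed
  have goal: "norm (u - u') \<le> 6 / \<kappa> * norm (e - e')"
  proof (cases "\<kappa> \<le> norm (e - e')")
    case True
    have "norm (u - u') \<le> 2" using norm_triangle_ineq4[of u u'] u by simp
    also have "\<dots> \<le> 6 / \<kappa> * \<kappa>" using \<kappa> by simp
    also have "\<dots> \<le> 6 / \<kappa> * norm (e - e')" using True \<kappa> by (intro mult_left_mono) auto
    finally show ?thesis .
  next
    case False
    have "e' \<bullet> u = e \<bullet> u - (e - e') \<bullet> u" by (simp add: inner_simps)
    then have "e' \<bullet> u \<ge> 0" using eu[OF e(1) u(1) v(1) tb(1,2)] Cauchy_Schwarz_ineq2[of "e - e'" u] u False by simp
    then have k: "\<kappa> \<le> e' \<bullet> (u + u')" using eu[OF e(2) u(2) v(2) tb(3,4)] by (simp add: inner_simps)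
    have d: "u - u' = t *\<^sub>R (e - e') + (t - t') *\<^sub>R e'"
      using arg_cong2[OF v, of "(-)"] by (simp add: algebra_simps)
    \<comment> \<open>The chord \<open>u - u'\<close> is orthogonal to \<open>u + u'\<close>.
      Pairing the decomposition \<open>d\<close> with \<open>u + u'\<close> therefore expresses
      \<open>t - t'\<close> through \<open>e - e'\<close>, with a coefficient of at least
      \<open>\<kappa>\<close>.\<close>
    have "(u - u') \<bullet> (u + u') = 0" using u by (simp add: inner_simps norm_eq_1 inner_commute)
    then have "(t - t') * (e' \<bullet> (u + u')) = - t * ((e - e') \<bullet> (u + u'))"
      unfolding d by (simp add: inner_simps algebra_simps)
    then have "\<bar>t - t'\<bar> * \<bar>e' \<bullet> (u + u')\<bar> = t * \<bar>(e - e') \<bullet> (u + u')\<bar>"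
      using t by (metis abs_minus_cancel abs_mult abs_of_nonneg mult_minus_left)
    also have "\<dots> \<le> t * (norm (e - e') * 2)"
      using Cauchy_Schwarz_ineq2[of "e - e'" "u + u'"] norm_triangle_ineq[of u u'] u t
      by (intro mult_left_mono order_trans[OF Cauchy_Schwarz_ineq2]) auto
    finally have "\<bar>t - t'\<bar> * \<kappa> \<le> 2 * t * norm (e - e')"
      using k \<kappa> mult_left_mono[of \<kappa> "\<bar>e' \<bullet> (u + u')\<bar>" "\<bar>t - t'\<bar>"] by linarith
    also have "\<dots> \<le> 4 * norm (e - e')" using tb c by (intro mult_right_mono) auto
    finally have tt: "\<bar>t - t'\<bar> \<le> 4 / \<kappa> * norm (e - e')" using \<kappa> by (simp add: field_simps)
    have "norm (u - u') \<le> t * norm (e - e') + \<bar>t - t'\<bar>"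
      unfolding d using norm_triangle_ineq[of "t *\<^sub>R (e - e')" "(t - t') *\<^sub>R e'"] t e by simp
    also have "\<dots> \<le> 2 / \<kappa> * norm (e - e') + 4 / \<kappa> * norm (e - e')"
    proof (intro add_mono tt mult_right_mono)
      have "t \<le> 2" using tb c by linarith
      also have "\<dots> \<le> 2 / \<kappa>" using \<kappa> by (simp add: field_simps)
      finally show "t \<le> 2 / \<kappa>" .
    qed auto
    finally show ?thesis by (simp add: algebra_simps)
  qed
  then show ?thesis by (simp add: \<kappa>_def field_simps)
qed

lemma compact_family_gap:
  fixes S :: "'i \<Rightarrow> 'a::heine_borel set"
  assumes "finite I" and "\<And>i. i \<in> I \<Longrightarrow> compact (S i)"
    and "\<And>i j. i \<in> I \<Longrightarrow> j \<in> I \<Longrightarrow> i \<noteq> j \<Longrightarrow> S i \<inter> S j = {}"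
  obtains d where "0 < d" "\<And>i j x y. i \<in> I \<Longrightarrow> j \<in> I \<Longrightarrow> i \<noteq> j \<Longrightarrow> x \<in> S i \<Longrightarrow> y \<in> S j \<Longrightarrow> d \<le> dist x y"
proof -
  let ?P = "{(i, j). i \<in> I \<and> j \<in> I \<and> i \<noteq> j}"
  have fin: "finite ?P" using assms(1) by (intro finite_subset[OF _ finite_cartesian_product[of I I]]) auto
  have "\<forall>p\<in>?P. \<exists>d. 0 < d \<and> (\<forall>x\<in>S (fst p). \<forall>y\<in>S (snd p). d \<le> dist x y)"
  proof
    fix p assume "p \<in> ?P"
    then show "\<exists>d. 0 < d \<and> (\<forall>x\<in>S (fst p). \<forall>y\<in>S (snd p). d \<le> dist x y)"
      using assms separate_compact_closed[of "S (fst p)" "S (snd p)"] by (auto simp: compact_imp_closed)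
  qed
  then obtain f where f: "\<forall>p\<in>?P. 0 < f p \<and> (\<forall>x\<in>S (fst p). \<forall>y\<in>S (snd p). f p \<le> dist x y)"
    by (rule bchoice[THEN exE])
  \<comment> \<open>The 1 keeps the set nonempty when there is no pair of distinct indices.\<close>
  define d :: real where "d = Min (insert 1 (f ` ?P))"
  show ?thesis
  proof (rule that)
    show "d > 0" unfolding d_def using fin f by (subst Min_gr_iff) auto
    fix i j x y assume *: "i \<in> I" "j \<in> I" "i \<noteq> j" "x \<in> S i" "y \<in> S j"
    have "d \<le> f (i, j)" unfolding d_def using fin * by (intro Min_le) auto
    also have "f (i, j) \<le> dist x y" using bspec[OF f, of "(i, j)"] * by simp
    finally show "d \<le> dist x y" .
  qed
qed

section \<open>Homothetic iterated function systems\<close>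

lemma compact_proj_graph:
  assumes F: "compact F"
  shows "compact {(\<theta>, t). \<theta> \<in> {0..pi} \<and> t \<in> proj \<theta> ` F}"
proof -
  have "{(\<theta>, t). \<theta> \<in> {0..pi} \<and> t \<in> proj \<theta> ` F} = (\<lambda>(\<theta>, x). (\<theta>, proj \<theta> x)) ` ({0..pi} \<times> F)"
    by auto
  also have "compact \<dots>"
    unfolding proj_def case_prod_unfold using F
    by (intro compact_continuous_image compact_Times continuous_intros) auto
  finally show ?thesis .
qed

text \<open>Tonelli for a compact subset of the plane. It yields the measurability of the integrand
  and turns limits of \<open>Fav\<close> along decreasing sets into continuity from above of one
  measure.\<close>

lemma Fav_eq_emeasure:
  assumes F: "compact F"
  shows "Fav F = emeasure lborel {(\<theta>, t). \<theta> \<in> {0..pi} \<and> t \<in> proj \<theta> ` F}" (is "_ = emeasure _ ?W")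
    and "(\<lambda>\<theta>. emeasure lebesgue (proj \<theta> ` F) * indicator {0..pi} \<theta>) \<in> borel_measurable lborel"
proof -
  have W: "?W \<in> sets (lborel \<Otimes>\<^sub>M lborel)"
    unfolding lborel_prod using compact_proj_graph[OF F] by (simp add: compact_imp_closed)
  have eq: "emeasure lborel (Pair \<theta> -` ?W) = emeasure lebesgue (proj \<theta> ` F) * indicator {0..pi} \<theta>" for \<theta>
    using compact_proj_image[OF F, of \<theta>] by (cases "\<theta> \<in> {0..pi}") (auto simp: vimage_def compact_imp_closed)
  show "Fav F = emeasure lborel ?W"
    unfolding Fav_def by (subst lborel_prod[symmetric], subst lborel.emeasure_pair_measure_alt[OF W]) (simp only: eq)
  show "(\<lambda>\<theta>. emeasure lebesgue (proj \<theta> ` F) * indicator {0..pi} \<theta>) \<in> borel_measurable lborel"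
    using lborel.measurable_emeasure_Pair[OF W] by (simp only: eq)
qed

locale homothetic_ifs =
  fixes L :: nat and b :: "nat \<Rightarrow> real^2"
  assumes L2: "2 \<le> L"
begin

definition words :: "nat \<Rightarrow> nat list set" where
  "words m = {w. set w \<subseteq> {1..L} \<and> length w = m}"

primrec base :: "nat list \<Rightarrow> real^2" where
  "base [] = 0"
| "base (i # w) = contr L b i (base w)"

definition mesh :: "nat \<Rightarrow> real" where
  "mesh m = (1 / real L) ^ m"

text \<open>The composition of the contractions along \<open>w\<close>, the first letter applied
  last; \<open>base w\<close> is its value at the origin.\<close>

definition cell :: "nat list \<Rightarrow> real^2 \<Rightarrow> real^2" where
  "cell w x = mesh (length w) *\<^sub>R x + base w"

definition level :: "(real^2) set \<Rightarrow> nat \<Rightarrow> (real^2) set" where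
  "level Q m = (\<Union>w\<in>words m. cell w ` Q)"

lemma mesh_pos [simp]: "0 < mesh m" "0 \<le> mesh m" "mesh m \<noteq> 0"
  using L2 by (auto simp: mesh_def)

lemma mesh_0 [simp]: "mesh 0 = 1" by (simp add: mesh_def)

lemma mesh_Suc: "mesh (Suc m) = mesh m / L"
  by (simp add: mesh_def)

text \<open>The number of cells times their scale is 1, that is, the similarity dimension is 1. The
  scales in sums over cells and sectors cancel for this reason.\<close>

lemma mesh_mult_power: "mesh m * real L ^ m = 1" "real L ^ m * mesh m = 1"
  using L2 by (auto simp: mesh_def power_divide)

lemma mesh_tendsto_0: "mesh \<longlonglongrightarrow> 0"
  unfolding mesh_def using L2 by (intro LIMSEQ_power_zero) auto

lemma mesh_antimono: "m \<le> k \<Longrightarrow> mesh k \<le> mesh m"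
  unfolding mesh_def using L2 by (intro power_decreasing) auto

lemma finite_words [simp]: "finite (words m)"
  unfolding words_def using finite_lists_length_eq[of "{1..L}" m] by simp

lemma card_words: "card (words m) = L ^ m"
  unfolding words_def using card_lists_length_eq[of "{1..L}" m] by simp

lemma length_words: "w \<in> words m \<Longrightarrow> length w = m"
  by (simp add: words_def)

lemma words_0 [simp]: "words 0 = {[]}"
  by (auto simp: words_def)

lemma words_Suc: "words (Suc m) = (\<Union>i\<in>{1..L}. (#) i ` words m)"
  by (auto simp: words_def length_Suc_conv)

lemma words_append: "words (m + k) = {v @ w |v w. v \<in> words m \<and> w \<in> words k}"
proof (intro equalityI subsetI)
  fix u assume "u \<in> words (m + k)"
  then have "u = take m u @ drop m u" "take m u \<in> words m" "drop m u \<in> words k"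
    by (auto simp: words_def dest: in_set_takeD in_set_dropD)
  then show "u \<in> {v @ w |v w. v \<in> words m \<and> w \<in> words k}" by blast
qed (auto simp: words_def subset_iff)

lemma cell_Nil [simp]: "cell [] x = x" by (simp add: cell_def)

lemma cell_Cons: "cell (i # w) x = contr L b i (cell w x)"
  by (simp add: cell_def contr_def mesh_Suc scaleR_add_right)

lemma cell_append: "cell (v @ w) x = cell v (cell w x)"
  by (induction v) (simp_all add: cell_Cons)

lemma level_0 [simp]: "level Q 0 = Q" by (simp add: level_def)

lemma level_add: "level Q (m + k) = (\<Union>w\<in>words m. cell w ` level Q k)"
  by (fastforce simp: level_def words_append cell_append)

lemma level_Suc: "level Q (Suc n) = (\<Union>i\<in>{1..L}. contr L b i ` level Q n)"
  by (fastforce simp: level_def words_Suc cell_Cons)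

lemma level_approx_eq_level: "level_approx L b n = level (cbox 0 1) n"
  by (induction n) (simp_all add: level_Suc)

lemma level_level: "level (level Q k) m = level Q (m + k)"
  by (simp add: level_add) (simp add: level_def)

lemma continuous_cell: "continuous_on S (cell w)"
  unfolding cell_def by (intro continuous_intros)

lemma compact_level: "compact Q \<Longrightarrow> compact (level Q m)"
  unfolding level_def by (intro compact_UN compact_continuous_image continuous_cell) auto

lemma level_mono: "P \<subseteq> Q \<Longrightarrow> level P m \<subseteq> level Q m"
  by (auto simp: level_def)

lemma level_fixed:
  assumes "E = (\<Union>i\<in>{1..L}. contr L b i ` E)"
  shows "level E m = E"
proof (induction m)
  case (Suc m)
  then show ?case using assms by (simp add: level_Suc)
qed simp

lemma dist_cell: "norm (cell w x - cell w y) = mesh (length w) * norm (x - y)"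
  by (simp add: cell_def scaleR_diff_right[symmetric])

text \<open>Since \<open>L \<ge> 2\<close>, a disc about the origin of radius at least
  \<open>2 * norm (b i)\<close> for all \<open>i\<close> is mapped into itself by every contraction,
  which nests its levels.\<close>

lemma bounding_radius:
  assumes "bounded Q"
  obtains R where "1 \<le> R" "Q \<subseteq> cball 0 R" "\<And>m. level (cball 0 R) (Suc m) \<subseteq> level (cball 0 R) m"
    "\<And>m. level (cball 0 R) m \<subseteq> cball 0 R" "\<And>w m. w \<in> words m \<Longrightarrow> base w \<in> cball 0 R"
proof -
  obtain R0 where R0: "Q \<subseteq> cball 0 R0" using assms unfolding bounded_any_center[where a=0] by (auto simp: subset_iff)
  define R where "R = max 1 (max R0 (2 * Max ((\<lambda>i. norm (b i)) ` {1..L})))"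
  have R: "1 \<le> R" "R0 \<le> R" "2 * Max ((\<lambda>i. norm (b i)) ` {1..L}) \<le> R" by (auto simp: R_def)
  have bi: "norm (b i) \<le> R / 2" if "i \<in> {1..L}" for i
  proof -
    have "norm (b i) \<le> Max ((\<lambda>i. norm (b i)) ` {1..L})" using that by (intro Max_ge) auto
    then show ?thesis using R by linarith
  qed
  have con: "contr L b i ` cball 0 R \<subseteq> cball 0 R" if i: "i \<in> {1..L}" for i
  proof
    fix y assume "y \<in> contr L b i ` cball 0 R"
    then obtain x where x: "norm x \<le> R" "y = contr L b i x" by auto
    have "norm y \<le> norm x / L + norm (b i)" unfolding x(2) contr_def using norm_triangle_ineq[of "(1 / real L) *\<^sub>R x" "b i"] by simp
    also have "\<dots> \<le> R / 2 + R / 2"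
    proof (intro add_mono bi i)
      have "norm x / L \<le> R / L" using x L2 by (intro divide_right_mono) auto
      also have "\<dots> \<le> R / 2" using R L2 by (intro divide_left_mono) auto
      finally show "norm x / L \<le> R / 2" .
    qed
    finally show "y \<in> cball 0 R" by simp
  qed
  then have sub1: "level (cball 0 R) 1 \<subseteq> cball 0 R"
    using level_Suc[of "cball 0 R" 0] by (simp del: One_nat_def add: One_nat_def[symmetric] UN_subset_iff)
  have dec: "level (cball 0 R) (Suc m) \<subseteq> level (cball 0 R) m" for m
    using level_mono[OF sub1, of m] by (simp add: level_level)
  have sub: "level (cball 0 R) m \<subseteq> cball 0 R" for m
    by (induction m) (use dec in auto)
  show ?thesis
  proof (rule that[OF _ _ dec sub])
    show "Q \<subseteq> cball 0 R" using R R0 subset_cball by (metis order_trans)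
    fix w m assume "w \<in> words m"
    then have "cell w 0 \<in> level (cball 0 R) m" using R unfolding level_def by (intro UN_I[of w] imageI) auto
    then show "base w \<in> cball 0 R" using sub[of m] by (auto simp: cell_def)
  qed (use R in auto)
qed

text \<open>Cutting the word of \<open>x\<close> after \<open>m\<close> letters leaves
  \<open>x\<close> in the image of the disc of radius \<open>R\<close> under the shortened cell map.
  Proximity replaces inclusion because the levels of \<open>Q\<close> need not be nested.\<close>

lemma level_near_coarser:
  assumes Q: "Q \<subseteq> cball 0 R" and lev: "\<And>j. level Q j \<subseteq> cball 0 R" and "m \<le> k" "x \<in> level Q k" "Q \<noteq> {}"
  obtains y where "y \<in> level Q m" "norm (x - y) \<le> 2 * R * mesh m"
proof -
  obtain j where j: "k = m + j" using \<open>m \<le> k\<close> le_Suc_ex by blast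
  obtain w z where w: "w \<in> words m" "z \<in> level Q j" "x = cell w z"
    using assms(4) unfolding j level_add by auto
  obtain q where q: "q \<in> Q" using assms(5) by blast
  have "norm (x - cell w q) = mesh m * norm (z - q)" using w by (simp add: dist_cell length_words)
  also have "\<dots> \<le> mesh m * (2 * R)"
  proof (intro mult_left_mono)
    have "norm z \<le> R" "norm q \<le> R" using w q Q lev[of j] by auto
    then show "norm (z - q) \<le> 2 * R" using norm_triangle_ineq4[of z q] by linarith
  qed auto
  finally have "norm (x - cell w q) \<le> 2 * R * mesh m" by (simp add: mult_ac)
  moreover have "cell w q \<in> level Q m" using w q by (auto simp: level_def)
  ultimately show ?thesis using that by blast
qed

text \<open>A cell is a convex copy of \<open>Q\<close> shrunk by \<open>mesh m\<close>, so from
  each of its points it extends proportionally far along every \<open>v\<close>. Projected, this is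
  the segment hypothesis of \<open>emeasure_thickening_le\<close>.\<close>

lemma level_thick:
  assumes Q: "convex Q" and thick: "\<And>x v. x \<in> Q \<Longrightarrow> norm v = 1 \<Longrightarrow> \<exists>q\<in>Q. \<kappa> \<le> \<bar>v \<bullet> (q - x)\<bar>"
    and x: "x \<in> level Q m" and v: "norm v = 1"
  obtains y where "y \<in> level Q m" "\<kappa> * mesh m \<le> \<bar>v \<bullet> (y - x)\<bar>" "closed_segment x y \<subseteq> level Q m"
proof -
  obtain w z where w: "w \<in> words m" "z \<in> Q" "x = cell w z" using x unfolding level_def by auto
  obtain q where q: "q \<in> Q" "\<kappa> \<le> \<bar>v \<bullet> (q - z)\<bar>" using thick[OF w(2) v] by blast
  have "cell w q - x = mesh m *\<^sub>R (q - z)" using w by (simp add: cell_def length_words scaleR_diff_right)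
  then have "\<bar>v \<bullet> (cell w q - x)\<bar> = mesh m * \<bar>v \<bullet> (q - z)\<bar>" by (simp add: abs_mult)
  then have 1: "\<kappa> * mesh m \<le> \<bar>v \<bullet> (cell w q - x)\<bar>" using q by (simp add: mult.commute mult_left_mono)
  have "convex (cell w ` Q)" unfolding cell_def using Q
    by (metis (no_types, lifting) add.commute convex_affinity image_cong)
  then have "closed_segment x (cell w q) \<subseteq> cell w ` Q"
    using w q by (intro closed_segment_subset) auto
  also have "\<dots> \<subseteq> level Q m" using w by (auto simp: level_def)
  finally show ?thesis using that 1 w q by (auto simp: level_def)
qed

end

section \<open>Circles with centres in a cell\<close>

text \<open>\<open>Q\<close> is left open because the unit square serves for the area estimate and a
  large disc for the null set. \<open>G\<close> stands for the gradient of \<open>r\<close>;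
  \<open>lip\<close> and \<open>taylor\<close> are all the smoothness that enters, on a ball
  containing every centre that occurs.\<close>

locale circle_bundle = homothetic_ifs +
  fixes Q :: "(real^2) set" and r :: "real^2 \<Rightarrow> real" and G :: "real^2 \<Rightarrow> real^2"
    and \<kappa> R a\<^sub>0 b\<^sub>0 c K :: real
  assumes Q: "compact Q" "convex Q" "Q \<noteq> {}" "Q \<subseteq> cball 0 R" "1 \<le> R" "0 < \<kappa>"
    and thick: "\<And>x v. x \<in> Q \<Longrightarrow> norm v = 1 \<Longrightarrow> \<exists>q\<in>Q. \<kappa> \<le> \<bar>v \<bullet> (q - x)\<bar>"
    and level_cball: "\<And>m. level Q m \<subseteq> cball 0 R"
    and base_cball: "\<And>w m. w \<in> words m \<Longrightarrow> base w \<in> cball 0 R"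
    and r: "0 < a\<^sub>0" "\<And>x. a\<^sub>0 \<le> r x" "\<And>x. r x \<le> b\<^sub>0"
    and c: "0 \<le> c" "c < 1" "\<And>x. norm (G x) \<le> c"
    and lip: "\<And>x y. \<bar>r x - r y\<bar> \<le> norm (x - y)"
    and taylor: "0 \<le> K" "\<And>x y. x \<in> cball 0 R \<Longrightarrow> y \<in> cball 0 R \<Longrightarrow>
        \<bar>r y - r x - G x \<bullet> (y - x)\<bar> \<le> K * (norm (y - x))\<^sup>2"
begin

text \<open>\<open>\<rho>\<close> bounds, in units of \<open>mesh m\<close>, the part of a circle seen in one angular sector, \<open>N\<close> is the
  constant of the linearization error, and \<open>M\<close> counts the translates needed to absorb that error.\<close>

definition \<rho> :: real where "\<rho> = 2 * R + b\<^sub>0 * (6 * (1 + c) / (1 - c)) * pi"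

definition N :: real where "N = K * R\<^sup>2 + 4 * (\<rho> + R)\<^sup>2 / a\<^sub>0 + 2 * (pi * R + 2 * R)"

definition M :: nat where "M = nat \<lceil>N / (\<kappa> * (1 - c))\<rceil>"

text \<open>The factors come from the diameter \<open>2 * \<rho>\<close> of a ball, the bound
  \<open>t \<le> 2\<close> on the scaling and the \<open>2 * M + 1\<close> translates.\<close>

definition A :: real where "A = 4 * \<rho> * (2 * real M + 1)"

definition circles :: "nat list \<Rightarrow> nat \<Rightarrow> (real^2) set" where
  "circles w j = (\<Union>x\<in>cell w ` level Q j. sphere x (r x))"

lemma b0_pos: "0 < b\<^sub>0" using r(1) r(2,3)[of 0] by linarith

lemma rho_pos: "0 < \<rho>"
  using Q(5) b0_pos c unfolding \<rho>_def by (intro add_pos_nonneg mult_nonneg_nonneg) auto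

lemma A_nonneg: "0 \<le> A" using rho_pos by (simp add: A_def)

lemma M_bound: "N / (1 - c) \<le> real M * \<kappa>"
proof -
  have "N / (\<kappa> * (1 - c)) \<le> real M" unfolding M_def by (simp add: real_nat_ceiling_ge)
  then have "N / (\<kappa> * (1 - c)) * \<kappa> \<le> real M * \<kappa>" using Q(6) by (intro mult_right_mono) auto
  then show ?thesis using Q(6) c by simp
qed

lemma compact_circles: "compact (circles w j)"
proof -
  have "continuous_on UNIV r"
    by (rule lipschitz_on_continuous_on[of 1]) (use lip in \<open>auto intro!: lipschitz_onI simp: dist_norm\<close>)
  then have "continuous_on (cell w ` level Q j) r" by (rule continuous_on_subset) auto
  then show ?thesis unfolding circles_def
    using Q(1) r(1,2) by (intro compact_Union_sphere compact_continuous_image continuous_cell compact_level) (auto intro: less_le_trans)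
qed

text \<open>At the scale \<open>mesh m\<close> a circle centred in the cell of \<open>w\<close> is straight up to an error of order
  \<open>(mesh m)\<^sup>2\<close>, and moving the centre by \<open>h\<close> displaces it by \<open>(u + \<nabla>r) \<bullet> h\<close> along \<open>u\<close>.\<close>

lemma circle_linearization:
  assumes w: "w \<in> words m" and h: "m \<le> j" "h \<in> level Q j"
    and u: "norm u = 1" and v: "u + G (base w) = (t * s) *\<^sub>R dir \<phi>'" and t: "0 \<le> t" and s: "s = 1 \<or> s = -1"
    and y: "y \<in> sphere (cell w h) (r (cell w h))" "norm (y - (base w + r (base w) *\<^sub>R u)) \<le> \<rho> * mesh m"
    and \<phi>: "\<bar>\<phi>' - \<phi>\<bar> \<le> pi * mesh m"
  obtains h' where "h' \<in> level Q m"
    "\<bar>u \<bullet> (y - (base w + r (base w) *\<^sub>R u)) - mesh m * t * s * proj \<phi> h'\<bar> \<le> N * (mesh m)\<^sup>2"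
proof -
  define d where "d = mesh m"
  define x0 where "x0 = base w"
  define g where "g = G x0"
  define p where "p = x0 + r x0 *\<^sub>R u"
  define x where "x = cell w h"
  have d: "0 < d" by (simp add: d_def)
  have x: "x = d *\<^sub>R h + x0" using w by (simp add: x_def cell_def d_def x0_def length_words)
  have hR: "norm h \<le> R" using h(2) level_cball[of j] by auto
  have xR: "x \<in> cball 0 R" "x0 \<in> cball 0 R"
  proof -
    have "x \<in> level Q (m + j)" using w h by (auto simp: level_add x_def)
    then show "x \<in> cball 0 R" using level_cball by blast
  qed (use w base_cball x0_def in auto)
  \<comment> \<open>Chosen so that \<open>y - x\<close> is the radial vector
    \<open>r x0 *\<^sub>R u\<close> plus \<open>q\<close>, with \<open>q\<close> of order
    \<open>d\<close>.\<close>
  define q where "q = y - p - d *\<^sub>R h"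
  have "norm q \<le> norm (y - p) + norm (d *\<^sub>R h)" unfolding q_def by (rule norm_triangle_ineq4)
  also have "\<dots> \<le> \<rho> * d + d * R"
    using y(2) hR d unfolding p_def x0_def d_def by (intro add_mono) auto
  finally have qn: "norm q \<le> (\<rho> + R) * d" by (simp add: algebra_simps)
  have "r x0 *\<^sub>R u + q = y - x" by (simp add: q_def p_def x)
  then have "norm (r x0 *\<^sub>R u + q) = r x" using y(1) by (simp add: x_def dist_norm norm_minus_commute)
  then have "\<bar>r x - (r x0 + u \<bullet> q)\<bar> \<le> 4 * norm q ^ 2 / a\<^sub>0"
    using norm_radial_approx[OF u r(1) r(2)[of x0], of q] by simp
  also have "\<dots> \<le> 4 * ((\<rho> + R) * d)\<^sup>2 / a\<^sub>0"
    using qn r(1) by (intro divide_right_mono mult_left_mono power_mono) auto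
  finally have 1: "\<bar>r x - (r x0 + u \<bullet> q)\<bar> \<le> 4 * (\<rho> + R)\<^sup>2 / a\<^sub>0 * d\<^sup>2" by (simp add: power_mult_distrib)
  have "\<bar>r x - r x0 - g \<bullet> (x - x0)\<bar> \<le> K * (norm (x - x0))\<^sup>2"
    unfolding g_def using taylor(2)[OF xR(2,1)] by simp
  also have "\<dots> \<le> K * (d * R)\<^sup>2"
    using hR d taylor(1) by (intro mult_left_mono power_mono) (auto simp: x)
  finally have 2: "\<bar>r x - r x0 - d * (g \<bullet> h)\<bar> \<le> K * R\<^sup>2 * d\<^sup>2" by (simp add: x power_mult_distrib mult_ac)
  have "u \<bullet> q = u \<bullet> (y - p) - d * (u \<bullet> h)" by (simp add: q_def inner_diff_right)
  then have 3: "\<bar>u \<bullet> (y - p) - d * ((u + g) \<bullet> h)\<bar> \<le> (K * R\<^sup>2 + 4 * (\<rho> + R)\<^sup>2 / a\<^sub>0) * d\<^sup>2"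
    using 1 2 by (simp add: inner_simps algebra_simps)
  \<comment> \<open>Passing to level \<open>m\<close> moves the rescaled centre by
    \<open>O(d)\<close>. Multiplied by \<open>d\<close>, this has the order of the curvature error,
    so forgetting the deeper levels costs nothing more.\<close>
  obtain h' where h': "h' \<in> level Q m" "norm (h - h') \<le> 2 * R * d"
    using level_near_coarser[OF Q(4) level_cball h(1) h(2) Q(3)] unfolding d_def by blast
  have "t = norm (u + g)" using v t s unfolding g_def x0_def by (auto simp: abs_mult)
  then have t2: "t \<le> 2" using norm_triangle_ineq[of u g] u c(2) c(3)[of x0] unfolding g_def by linarith
  have "\<bar>dir \<phi>' \<bullet> h - dir \<phi> \<bullet> h'\<bar> = \<bar>(dir \<phi>' - dir \<phi>) \<bullet> h + dir \<phi> \<bullet> (h - h')\<bar>" by (simp add: inner_simps)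
  also have "\<dots> \<le> norm (dir \<phi>' - dir \<phi>) * norm h + norm (h - h')"
    using Cauchy_Schwarz_ineq2[of "dir \<phi>' - dir \<phi>" h] Cauchy_Schwarz_ineq2[of "dir \<phi>" "h - h'"] by simp
  also have "\<dots> \<le> (pi * d) * R + 2 * R * d"
    using order_trans[OF dir_diff_le \<phi>] hR h'(2) d by (intro add_mono mult_mono) (auto simp: d_def)
  finally have "\<bar>dir \<phi>' \<bullet> h - dir \<phi> \<bullet> h'\<bar> \<le> (pi * R + 2 * R) * d" by (simp add: algebra_simps)
  then have "(d * t) * \<bar>dir \<phi>' \<bullet> h - dir \<phi> \<bullet> h'\<bar> \<le> (d * 2) * ((pi * R + 2 * R) * d)"
    using d t t2 by (intro mult_mono) auto
  moreover have "\<bar>d * ((u + g) \<bullet> h) - d * t * s * proj \<phi> h'\<bar> = (d * t) * \<bar>dir \<phi>' \<bullet> h - dir \<phi> \<bullet> h'\<bar>"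
  proof -
    have "d * ((u + g) \<bullet> h) - d * t * s * proj \<phi> h' = (d * t) * s * (dir \<phi>' \<bullet> h - dir \<phi> \<bullet> h')"
      using v by (simp add: g_def x0_def proj_eq_inner algebra_simps)
    then show ?thesis using d t s by (auto simp: abs_mult)
  qed
  \<comment> \<open>The three terms of \<open>N\<close> bound the Taylor error of \<open>r\<close>,
    the curvature of the circle, and the replacement of \<open>\<phi>'\<close> and \<open>h\<close>
    by \<open>\<phi>\<close> and \<open>h'\<close>; the factor 2 in the last is the bound for
    \<open>t\<close>.\<close>
  ultimately have "\<bar>u \<bullet> (y - p) - d * t * s * proj \<phi> h'\<bar> \<le> N * d\<^sup>2"
    using 3 unfolding N_def by (simp add: algebra_simps power2_eq_square)
  then show ?thesis using that[OF h'(1)] by (simp add: p_def x0_def d_def)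
qed

text \<open>The circles lie in a slab whose section along \<open>u\<close> is the projection of
  level \<open>m\<close>, scaled by \<open>mesh m * t\<close> and enlarged by
  \<open>N * (mesh m)\<^sup>2\<close>. Once the scaling is undone, the enlargement is comparable to
  the cell width and costs a constant factor. One power of \<open>mesh m\<close> is the length of
  the slab, the other the scaling.\<close>

lemma circles_ball_measure:
  assumes w: "w \<in> words m" and j: "m \<le> j"
    and u: "norm u = 1" and v: "u + G (base w) = (t * s) *\<^sub>R dir \<phi>'" and t: "0 \<le> t" and s: "s = 1 \<or> s = -1"
    and \<phi>: "\<bar>\<phi>' - \<phi>\<bar> \<le> pi * mesh m"
  shows "emeasure lebesgue (circles w j \<inter> cball (base w + r (base w) *\<^sub>R u) (\<rho> * mesh m))
    \<le> ennreal (A * (mesh m)\<^sup>2) * emeasure lebesgue (proj \<phi> ` level Q m)"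
proof -
  define d where "d = mesh m"
  define p where "p = base w + r (base w) *\<^sub>R u"
  define P where "P = proj \<phi> ` level Q m"
  have d: "0 < d" by (simp add: d_def)
  have P: "compact P" unfolding P_def using Q(1) by (intro compact_proj_image compact_level)
  have tn: "t = norm (u + G (base w))" using v t s by (auto simp: abs_mult)
  have tb: "1 - c \<le> t" "t \<le> 2"
    unfolding tn using norm_triangle_ineq[of u "G (base w)"] norm_diff_ineq[of u "G (base w)"] u c(2) c(3)[of "base w"] by linarith+
  have t0: "0 < t" using tb c by linarith
  define B where "B = {x + y |x y. x \<in> P \<and> y \<in> cball (0::real) (real M * (\<kappa> * d))}"
  have B: "compact B" unfolding B_def using P by (intro compact_sums) auto
  have "emeasure lebesgue B \<le> ennreal (2 * real M + 1) * emeasure lebesgue P"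
  proof (rule emeasure_thickening_le[where d="\<kappa> * d"])
    show "P \<in> sets lebesgue" using P by (simp add: compact_imp_closed)
    show "0 < \<kappa> * d" using d Q by simp
    show "B \<subseteq> {x. \<exists>a\<in>P. \<bar>x - a\<bar> \<le> real M * (\<kappa> * d)}" unfolding B_def by force
    fix z assume "z \<in> P"
    then obtain x where x: "x \<in> level Q m" "z = proj \<phi> x" by (auto simp: P_def)
    obtain y where y: "y \<in> level Q m" "\<kappa> * mesh m \<le> \<bar>dir \<phi> \<bullet> (y - x)\<bar>" "closed_segment x y \<subseteq> level Q m"
      using level_thick[OF Q(2) thick x(1) norm_dir] by blast
    have "linear (proj \<phi>)" unfolding proj_eq_inner by (simp add: bounded_linear.linear bounded_linear_inner_right)
    then have "closed_segment z (proj \<phi> y) = proj \<phi> ` closed_segment x y"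
      unfolding x(2) by (rule closed_segment_linear_image)
    then show "\<exists>y\<in>P. \<kappa> * d \<le> \<bar>y - z\<bar> \<and> closed_segment z y \<subseteq> P"
      using y x by (intro bexI[of _ "proj \<phi> y"]) (auto simp: P_def d_def proj_eq_inner inner_diff_right)
  qed
  then have eB: "ennreal (d * t) * emeasure lebesgue B \<le> ennreal (d * 2) * (ennreal (2 * real M + 1) * emeasure lebesgue P)"
    using d tb t0 by (intro mult_mono) (auto intro!: ennreal_leI)
  define T where "T = (\<lambda>x. d * t * s * x) ` B"
  have T: "compact T" unfolding T_def by (intro compact_continuous_image continuous_intros B)
  have eT: "emeasure lebesgue T = ennreal (d * t) * emeasure lebesgue B"
  proof -
    have "\<bar>d * t * s\<bar> = d * t" using d t0 s by (auto simp: abs_mult)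
    then show ?thesis using emeasure_lebesgue_affine[of "d * t * s" 0 B] by (simp add: T_def)
  qed
  have "circles w j \<inter> cball p (\<rho> * d) \<subseteq> {y. norm (y - p) \<le> \<rho> * d \<and> u \<bullet> (y - p) \<in> T}"
  proof
    fix y assume y: "y \<in> circles w j \<inter> cball p (\<rho> * d)"
    then obtain h where h: "h \<in> level Q j" "y \<in> sphere (cell w h) (r (cell w h))" by (auto simp: circles_def)
    have yp: "norm (y - p) \<le> \<rho> * d" using y by (auto simp: dist_norm norm_minus_commute)
    obtain h' where h': "h' \<in> level Q m" "\<bar>u \<bullet> (y - p) - d * t * s * proj \<phi> h'\<bar> \<le> N * d\<^sup>2"
      using circle_linearization[OF w j h(1) u v t s h(2) yp[unfolded p_def d_def] \<phi>] unfolding p_def d_def by blast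
    define x where "x = u \<bullet> (y - p) / (d * t * s)"
    have nz: "d * t * s \<noteq> 0" using d t0 s by auto
    have x: "u \<bullet> (y - p) = d * t * s * x" using nz by (simp add: x_def)
    have "(d * t) * \<bar>x - proj \<phi> h'\<bar> = \<bar>d * t * s * (x - proj \<phi> h')\<bar>" using d t0 s by (auto simp: abs_mult)
    also have "\<dots> \<le> N * d\<^sup>2" using h'(2) unfolding x by (simp add: algebra_simps)
    finally have "t * \<bar>x - proj \<phi> h'\<bar> \<le> N * d" using d by (simp add: power2_eq_square)
    \<comment> \<open>Here \<open>c < 1\<close> enters: \<open>t\<close> stays away from 0, so
      dividing by it keeps the error of order \<open>d\<close>.\<close>
    moreover have "(1 - c) * \<bar>x - proj \<phi> h'\<bar> \<le> t * \<bar>x - proj \<phi> h'\<bar>" using tb by (intro mult_right_mono) auto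
    ultimately have "(1 - c) * \<bar>x - proj \<phi> h'\<bar> \<le> N * d" by linarith
    then have "\<bar>x - proj \<phi> h'\<bar> \<le> (N / (1 - c)) * d" using c by (simp add: field_simps)
    also have "\<dots> \<le> real M * \<kappa> * d" using M_bound d by (intro mult_right_mono) auto
    finally have "x - proj \<phi> h' \<in> cball 0 (real M * (\<kappa> * d))" by simp
    then have "x \<in> B" unfolding B_def P_def using h'(1) by (intro CollectI exI[of _ "proj \<phi> h'"] exI[of _ "x - proj \<phi> h'"]) auto
    then show "y \<in> {y. norm (y - p) \<le> \<rho> * d \<and> u \<bullet> (y - p) \<in> T}" using yp x by (auto simp: T_def)
  qed
  moreover have "closed {y. norm (y - p) \<le> \<rho> * d \<and> u \<bullet> (y - p) \<in> T}"
  proof -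
    have "closed (cball p (\<rho> * d) \<inter> (\<lambda>y. u \<bullet> (y - p)) -` T)"
      using T by (intro closed_Int closed_cball closed_vimage continuous_intros compact_imp_closed)
    then show ?thesis by (rule back_subst[of closed]) (auto simp: dist_norm norm_minus_commute)
  qed
  ultimately have "emeasure lebesgue (circles w j \<inter> cball p (\<rho> * d))
      \<le> emeasure lebesgue {y. norm (y - p) \<le> \<rho> * d \<and> u \<bullet> (y - p) \<in> T}"
    by (intro emeasure_mono) auto
  also have "\<dots> \<le> ennreal (2 * (\<rho> * d)) * emeasure lebesgue T"
    using emeasure_slab_le[OF u T] rho_pos d by simp
  also have "\<dots> \<le> ennreal (2 * (\<rho> * d)) * (ennreal (d * 2) * (ennreal (2 * real M + 1) * emeasure lebesgue P))"
    unfolding eT using eB by (intro mult_left_mono) auto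
  also have "\<dots> = ennreal (2 * (\<rho> * d) * (d * 2) * (2 * real M + 1)) * emeasure lebesgue P"
  proof -
    have p: "0 \<le> 2 * (\<rho> * d)" "0 \<le> d * 2" "0 \<le> 2 * real M + 1" using d rho_pos by auto
    show ?thesis
      unfolding ennreal_mult[OF mult_nonneg_nonneg[OF p(1,2)] p(3)] ennreal_mult[OF p(1,2)] by (simp only: mult.assoc)
  qed
  also have "2 * (\<rho> * d) * (d * 2) * (2 * real M + 1) = A * d\<^sup>2" by (simp add: A_def power2_eq_square)
  finally show ?thesis by (simp add: p_def d_def P_def)
qed

text \<open>The sectors are chosen by the direction of \<open>u + \<nabla>r\<close> rather than of \<open>u\<close>, which replaces the change
  of variables between the two angles by \<open>unit_shift_lipschitz\<close>.\<close>

lemma circles_sector_cover: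
  fixes m w j k s
  defines "Y \<equiv> {y \<in> circles w j. \<exists>u \<phi> t. norm u = 1 \<and> \<phi> \<in> {real k * (pi * mesh m)..(real k + 1) * (pi * mesh m)} \<and>
      0 \<le> t \<and> u + G (base w) = (t * s) *\<^sub>R dir \<phi> \<and> y = base w + norm (y - base w) *\<^sub>R u}"
  assumes w: "w \<in> words m" and j: "m \<le> j" and s: "s = 1 \<or> s = -1"
  obtains Z where "Y \<subseteq> Z" "Z \<in> sets lebesgue"
    "\<And>\<phi>. \<phi> \<in> {real k * (pi * mesh m)..(real k + 1) * (pi * mesh m)} \<Longrightarrow>
      emeasure lebesgue Z \<le> ennreal (A * (mesh m)\<^sup>2) * emeasure lebesgue (proj \<phi> ` level Q m)"
proof (cases "Y = {}")
  case True
  then show ?thesis by (intro that[of "{}"]) auto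
next
  case False
  define d where "d = mesh m"
  have d: "0 < d" by (simp add: d_def)
  define x0 where "x0 = base w"
  have angle: "\<bar>\<theta> - \<phi>\<bar> \<le> pi * d"
    if "\<theta> \<in> {real k * (pi * mesh m)..(real k + 1) * (pi * mesh m)}" "\<phi> \<in> {real k * (pi * mesh m)..(real k + 1) * (pi * mesh m)}" for \<theta> \<phi>
    using that by (simp add: d_def algebra_simps abs_le_iff)
  \<comment> \<open>An arbitrary member of \<open>Y\<close> fixes the centre of the ball, which is
    why the empty case is separate. The area bound then holds for any \<open>\<psi>\<close> in the
    sector, as it differs from \<open>\<phi>\<close> by at most the sector width.\<close>
  obtain u t \<phi> where u: "norm u = 1" "0 \<le> t" "u + G x0 = (t * s) *\<^sub>R dir \<phi>"
    and \<phi>: "\<phi> \<in> {real k * (pi * mesh m)..(real k + 1) * (pi * mesh m)}"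
    using False unfolding Y_def x0_def by blast
  define Z where "Z = circles w j \<inter> cball (x0 + r x0 *\<^sub>R u) (\<rho> * d)"
  show ?thesis
  proof (rule that[of Z])
    show "Z \<in> sets lebesgue" unfolding Z_def using compact_circles[of w j]
      by (intro sets.Int) (auto simp: compact_imp_closed)
    show "emeasure lebesgue Z \<le> ennreal (A * (mesh m)\<^sup>2) * emeasure lebesgue (proj \<psi> ` level Q m)"
      if "\<psi> \<in> {real k * (pi * mesh m)..(real k + 1) * (pi * mesh m)}" for \<psi>
      using circles_ball_measure[OF w j u(1) u(3)[unfolded x0_def] u(2) s] angle[OF \<phi> that] unfolding Z_def x0_def d_def by blast
    show "Y \<subseteq> Z"
    proof
      fix y assume "y \<in> Y"
      then obtain u' \<phi>' t' where u': "norm u' = 1" "0 \<le> t'" "u' + G x0 = (t' * s) *\<^sub>R dir \<phi>'"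
        and \<phi>': "\<phi>' \<in> {real k * (pi * mesh m)..(real k + 1) * (pi * mesh m)}"
        and y: "y \<in> circles w j" "y = x0 + norm (y - x0) *\<^sub>R u'"
        unfolding Y_def x0_def by blast
      obtain h where h: "h \<in> level Q j" "y \<in> sphere (cell w h) (r (cell w h))" using y(1) by (auto simp: circles_def)
      define x where "x = cell w h"
      have xx: "norm (x - x0) \<le> d * R"
        using h(1) level_cball[of j] w d by (auto simp: x_def cell_def x0_def d_def length_words)
      have yx: "norm (y - x) = r x" using h(2) by (simp add: x_def dist_norm norm_minus_commute)
      have "\<bar>norm (y - x0) - r x0\<bar> \<le> \<bar>norm (y - x0) - norm (y - x)\<bar> + \<bar>r x - r x0\<bar>" using yx by linarith
      also have "\<dots> \<le> norm (x - x0) + norm (x - x0)"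
        using lip[of x x0] norm_triangle_ineq3[of "y - x0" "y - x"] by (intro add_mono) auto
      also have "\<dots> \<le> 2 * R * d" using xx by (simp add: mult_ac)
      finally have rad: "\<bar>norm (y - x0) - r x0\<bar> \<le> 2 * R * d" .
      have "norm (u' - u) \<le> 6 * (1 + c) / (1 - c) * norm (s *\<^sub>R dir \<phi>' - s *\<^sub>R dir \<phi>)"
        using u u' s by (intro unit_shift_lipschitz[OF c(1,2) c(3)[of x0], where t=t' and t'=t]) auto
      also have "\<dots> = 6 * (1 + c) / (1 - c) * norm (dir \<phi>' - dir \<phi>)"
        using s by (auto simp: scaleR_diff_right[symmetric] norm_minus_commute)
      also have "\<dots> \<le> 6 * (1 + c) / (1 - c) * (pi * d)"
        using order_trans[OF dir_diff_le angle[OF \<phi>' \<phi>]] c by (intro mult_left_mono) auto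
      finally have uu: "norm (u' - u) \<le> 6 * (1 + c) / (1 - c) * (pi * d)" .
      \<comment> \<open>Splits the distance to the centre of the ball into a radial part, bounded by
        \<open>rad\<close>, and an angular part, bounded by \<open>uu\<close>; these are the two
        summands of \<open>\<rho>\<close>.\<close>
      have "y - (x0 + r x0 *\<^sub>R u) = (norm (y - x0) - r x0) *\<^sub>R u' + r x0 *\<^sub>R (u' - u)"
        by (subst y(2)) (simp add: algebra_simps)
      then have "norm (y - (x0 + r x0 *\<^sub>R u)) \<le> \<bar>norm (y - x0) - r x0\<bar> + r x0 * norm (u' - u)"
        using norm_triangle_ineq[of "(norm (y - x0) - r x0) *\<^sub>R u'" "r x0 *\<^sub>R (u' - u)"] u'(1) r(1) r(2)[of x0] by simp
      also have "\<dots> \<le> 2 * R * d + b\<^sub>0 * (6 * (1 + c) / (1 - c) * (pi * d))"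
        using rad uu r(3)[of x0] b0_pos by (intro add_mono mult_mono) auto
      also have "\<dots> = \<rho> * d" by (simp add: \<rho>_def algebra_simps)
      finally show "y \<in> Z" using y(1) by (simp add: Z_def dist_norm norm_minus_commute)
    qed
  qed
qed

text \<open>A bound valid for every \<open>\<phi>\<close> of a sector may be averaged over the
  sector, and the \<open>L ^ m\<close> sectors of width \<open>pi * mesh m\<close> tile the range of
  integration of \<open>Fav\<close>.\<close>

lemma sum_sectors_le_Fav:
  fixes z :: "nat \<Rightarrow> ennreal"
  assumes z: "\<And>k \<phi>. k < L ^ m \<Longrightarrow> \<phi> \<in> {real k * (pi * mesh m)..(real k + 1) * (pi * mesh m)} \<Longrightarrow>
      z k \<le> B * emeasure lebesgue (proj \<phi> ` level Q m)"
  shows "(\<Sum>k<L ^ m. z k) * ennreal (pi * mesh m) \<le> B * Fav (level Q m)"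
proof -
  define d where "d = pi * mesh m"
  have d: "0 < d" by (simp add: d_def)
  \<comment> \<open>Half-open, unlike the sectors of the hypothesis, so that each
    \<open>\<phi>\<close> meets at most one of them.\<close>
  define I where "I k = {real k * d..<(real k + 1) * d}" for k
  have cQ: "compact (level Q m)" using Q(1) by (rule compact_level)
  have em: "emeasure lborel (I k) = ennreal d" for k
    using d by (simp add: I_def algebra_simps)
  have "(\<Sum>k<L ^ m. z k) * ennreal d = (\<Sum>k<L ^ m. \<integral>\<^sup>+\<phi>. z k * indicator (I k) \<phi> \<partial>lborel)"
    unfolding sum_distrib_right
  proof (intro sum.cong refl)
    fix k
    have "I k \<in> sets lborel" by (simp add: I_def)
    then show "z k * ennreal d = (\<integral>\<^sup>+\<phi>. z k * indicator (I k) \<phi> \<partial>lborel)"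
      by (subst nn_integral_cmult_indicator) (simp_all add: em)
  qed
  also have "\<dots> = (\<integral>\<^sup>+\<phi>. (\<Sum>k<L ^ m. z k * indicator (I k) \<phi>) \<partial>lborel)"
    by (rule nn_integral_sum[symmetric]) (auto simp: I_def)
  also have "\<dots> \<le> (\<integral>\<^sup>+\<phi>. B * (emeasure lebesgue (proj \<phi> ` level Q m) * indicator {0..pi} \<phi>) \<partial>lborel)"
  proof (rule nn_integral_mono)
    fix \<phi> :: real
    show "(\<Sum>k<L ^ m. z k * indicator (I k) \<phi>) \<le> B * (emeasure lebesgue (proj \<phi> ` level Q m) * indicator {0..pi} \<phi>)"
    proof (cases "\<exists>k<L ^ m. \<phi> \<in> I k")
      case True
      then obtain k where k: "k < L ^ m" "\<phi> \<in> I k" by blast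
      have uniq: "\<phi> \<notin> I l" if "l \<noteq> k" for l
      proof
        assume "\<phi> \<in> I l"
        then have "real k * d < (real l + 1) * d" "real l * d < (real k + 1) * d" using k(2) by (auto simp: I_def)
        then have "real k < real l + 1" "real l < real k + 1" using d by (auto simp: mult_less_cancel_right)
        then show False using that by linarith
      qed
      have "(\<Sum>k<L ^ m. z k * indicator (I k) \<phi>) = (\<Sum>l\<in>{k}. z l * indicator (I l) \<phi>)"
        using k uniq by (intro sum.mono_neutral_right) (auto simp: indicator_def)
      also have "\<dots> = z k" using k by simp
      also have "\<dots> \<le> B * emeasure lebesgue (proj \<phi> ` level Q m)" using k by (intro z) (auto simp: I_def d_def)
      finally have 1: "(\<Sum>k<L ^ m. z k * indicator (I k) \<phi>) \<le> B * emeasure lebesgue (proj \<phi> ` level Q m)" .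
      have "real k + 1 \<le> real (L ^ m)" using k(1) by linarith
      then have "(real k + 1) * d \<le> real (L ^ m) * d" using d by (intro mult_right_mono) auto
      also have "\<dots> = pi" using mesh_mult_power[of m] by (simp add: d_def)
      finally have "\<phi> \<le> pi" using k(2) by (auto simp: I_def)
      moreover have "0 \<le> real k * d" using d by simp
      then have "0 \<le> \<phi>" using k(2) unfolding I_def by (meson atLeastLessThan_iff order_trans)
      ultimately show ?thesis using 1 by simp
    next
      case False
      then have "(\<Sum>k<L ^ m. z k * indicator (I k) \<phi>) = 0" by (intro sum.neutral) auto
      then show ?thesis by simp
    qed
  qed
  also have "\<dots> = B * Fav (level Q m)"
    unfolding Fav_def by (rule nn_integral_cmult) (use Fav_eq_emeasure(2)[OF cQ] in simp)
  finally show ?thesis by (simp add: d_def)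
qed

text \<open>Each sector costs \<open>(mesh m)\<^sup>2\<close> times a projection. Trading the
  projections for averages divides by the sector width \<open>pi * mesh m\<close>, so one factor
  \<open>mesh m\<close> remains; the 2 counts the signs.\<close>

lemma circles_le_Fav:
  assumes w: "w \<in> words m" and j: "m \<le> j"
  shows "emeasure lebesgue (circles w j) \<le> ennreal (2 * A / pi * mesh m) * Fav (level Q m)"
proof -
  define d where "d = mesh m"
  have d: "0 < d" by (simp add: d_def)
  define x0 where "x0 = base w"
  let ?I = "\<lambda>k. {real k * (pi * mesh m)..(real k + 1) * (pi * mesh m)}"
  define Y where "Y s k = {y \<in> circles w j. \<exists>u \<phi> t. norm u = 1 \<and> \<phi> \<in> ?I k \<and>
      0 \<le> t \<and> u + G (base w) = (t * s) *\<^sub>R dir \<phi> \<and> y = base w + norm (y - base w) *\<^sub>R u}" for s k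
  define good where "good s k Z \<longleftrightarrow> Y s k \<subseteq> Z \<and> Z \<in> sets lebesgue \<and> (\<forall>\<phi>\<in>?I k.
      emeasure lebesgue Z \<le> ennreal (A * (mesh m)\<^sup>2) * emeasure lebesgue (proj \<phi> ` level Q m))" for s k Z
  \<comment> \<open>One set per sector and sign, fixed before \<open>\<phi>\<close> varies: the
    averaging needs a left-hand side independent of \<open>\<phi>\<close>.\<close>
  define Z where "Z s k = (SOME Z. good s k Z)" for s k
  have "\<exists>Z. good s k Z" if s: "s = 1 \<or> s = -1" for s k
    by (rule circles_sector_cover[OF w j s, of k], unfold good_def Y_def) blast
  then have Z: "good s k (Z s k)" if "s = 1 \<or> s = -1" for s k
    using that unfolding Z_def by (metis someI_ex)
  have cover: "circles w j \<subseteq> (\<Union>k<L ^ m. Z 1 k) \<union> (\<Union>k<L ^ m. Z (-1) k)"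
  proof
    fix y assume y: "y \<in> circles w j"
    obtain u where u: "norm u = 1" "y = x0 + norm (y - x0) *\<^sub>R u"
    proof (cases "y = x0")
      case True
      then show ?thesis using that[of "dir 0"] by simp
    next
      case False
      then show ?thesis using that[of "(1 / norm (y - x0)) *\<^sub>R (y - x0)"] by simp
    qed
    define v where "v = u + G x0"
    \<comment> \<open>Again \<open>c < 1\<close>: the shifted vector has a direction for every
      \<open>u\<close>.\<close>
    have "norm v \<noteq> 0" using norm_diff_ineq[of u "G x0"] u(1) c(2) c(3)[of x0] unfolding v_def by linarith
    then have "norm ((1 / norm v) *\<^sub>R v) = 1" by simp
    then obtain s \<phi> where s: "s = 1 \<or> s = -1" and \<phi>: "0 \<le> \<phi>" "\<phi> \<le> pi" and e: "(1 / norm v) *\<^sub>R v = s *\<^sub>R dir \<phi>"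
      using unit_eq_dir_upto_sign by blast
    have "v = norm v *\<^sub>R ((1 / norm v) *\<^sub>R v)" using \<open>norm v \<noteq> 0\<close> by simp
    then have vd: "v = (norm v * s) *\<^sub>R dir \<phi>" unfolding e by simp
    obtain k where k: "k < L ^ m" "\<phi> \<in> ?I k"
    proof (cases "\<phi> = pi")
      case True
      \<comment> \<open>The angle \<open>pi\<close> is the right end of the last sector; the floor
        used in the other case would give the excluded index \<open>L ^ m\<close>.\<close>
      have L0: "0 < L ^ m" using L2 by simp
      have "real (L ^ m - 1) + 1 = real (Suc (L ^ m - 1))" by (simp only: of_nat_Suc add.commute)
      also have "\<dots> = real L ^ m" by (simp only: Suc_diff_1[OF L0] of_nat_power)
      finally have "real (L ^ m - 1) + 1 = real L ^ m" .
      then show ?thesis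
        using that[of "L ^ m - 1"] L0 True mesh_mult_power[of m] by (auto simp: algebra_simps)
    next
      case False
      define k where "k = nat \<lfloor>\<phi> / (pi * d)\<rfloor>"
      have k: "real k \<le> \<phi> / (pi * d)" "\<phi> / (pi * d) < real k + 1" using \<phi> d by (auto simp: k_def)
      have "real k * (pi * d) \<le> \<phi>" "\<phi> \<le> (real k + 1) * (pi * d)" using k d by (auto simp: field_simps)
      moreover have "\<phi> / (pi * d) < real L ^ m"
      proof -
        have "\<phi> < pi" using \<phi> False by simp
        then have "\<phi> < real L ^ m * d * pi" using mesh_mult_power[of m] by (simp add: d_def)
        then show ?thesis using d by (simp add: field_simps)
      qed
      then have "real k < real (L ^ m)" using k(1) unfolding of_nat_power by linarith
      ultimately show ?thesis using that[of k] unfolding d_def by (auto simp del: of_nat_power)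
    qed
    have "y \<in> Y s k" unfolding Y_def using y k(2) u vd unfolding v_def x0_def
      by (intro CollectI conjI exI[of _ u] exI[of _ \<phi>] exI[of _ "norm (u + G (base w))"]) simp_all
    then have "y \<in> Z s k" using Z[OF s] unfolding good_def by blast
    then show "y \<in> (\<Union>k<L ^ m. Z 1 k) \<union> (\<Union>k<L ^ m. Z (-1) k)" using s k(1) by auto
  qed
  have Zm: "Z s k \<in> sets lebesgue" if "s = 1 \<or> s = -1" for s k
    using Z[OF that] unfolding good_def by blast
  have meas: "(\<Union>k<L ^ m. Z s k) \<in> sets lebesgue" "emeasure lebesgue (\<Union>k<L ^ m. Z s k) \<le> (\<Sum>k<L ^ m. emeasure lebesgue (Z s k))"
    if "s = 1 \<or> s = -1" for s
  proof -
    show "(\<Union>k<L ^ m. Z s k) \<in> sets lebesgue" by (intro sets.finite_UN Zm that) simp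
    show "emeasure lebesgue (\<Union>k<L ^ m. Z s k) \<le> (\<Sum>k<L ^ m. emeasure lebesgue (Z s k))"
      by (rule emeasure_subadditive_finite) (use Zm[OF that] in auto)
  qed
  have bd: "(\<Sum>k<L ^ m. emeasure lebesgue (Z s k)) * ennreal (pi * mesh m) \<le> ennreal (A * (mesh m)\<^sup>2) * Fav (level Q m)"
    if "s = 1 \<or> s = -1" for s
    by (rule sum_sectors_le_Fav) (use Z[OF that] in \<open>unfold good_def, blast\<close>)
  have "emeasure lebesgue (circles w j) \<le> emeasure lebesgue ((\<Union>k<L ^ m. Z 1 k) \<union> (\<Union>k<L ^ m. Z (-1) k))"
    using meas by (intro emeasure_mono cover) auto
  also have "\<dots> \<le> (\<Sum>k<L ^ m. emeasure lebesgue (Z 1 k)) + (\<Sum>k<L ^ m. emeasure lebesgue (Z (-1) k))"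
    using meas by (intro order_trans[OF emeasure_subadditive] add_mono) auto
  finally have "emeasure lebesgue (circles w j) * ennreal (pi * d)
      \<le> ((\<Sum>k<L ^ m. emeasure lebesgue (Z 1 k)) + (\<Sum>k<L ^ m. emeasure lebesgue (Z (-1) k))) * ennreal (pi * d)"
    by (rule mult_right_mono) simp
  also have "\<dots> \<le> ennreal (A * d\<^sup>2) * Fav (level Q m) + ennreal (A * d\<^sup>2) * Fav (level Q m)"
    unfolding d_def distrib_right by (intro add_mono bd) auto
  also have "\<dots> = ennreal (2 * A * d\<^sup>2) * Fav (level Q m)"
  proof -
    have "ennreal (2 * A * d\<^sup>2) = ennreal (A * d\<^sup>2) + ennreal (A * d\<^sup>2)"
      using A_nonneg by (subst ennreal_plus[symmetric]) auto
    then show ?thesis by (simp add: distrib_right)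
  qed
  finally have "ennreal (1 / (pi * d)) * (emeasure lebesgue (circles w j) * ennreal (pi * d))
      \<le> ennreal (1 / (pi * d)) * (ennreal (2 * A * d\<^sup>2) * Fav (level Q m))"
    by (rule mult_left_mono) simp
  moreover have "ennreal (1 / (pi * d)) * (emeasure lebesgue (circles w j) * ennreal (pi * d)) = emeasure lebesgue (circles w j)"
  proof -
    have "ennreal (1 / (pi * d)) * ennreal (pi * d) = 1" using d by (subst ennreal_mult[symmetric]) auto
    then show ?thesis by (metis mult.commute mult.left_commute mult.right_neutral)
  qed
  moreover have "ennreal (1 / (pi * d)) * (ennreal (2 * A * d\<^sup>2) * Fav (level Q m)) = ennreal (2 * A / pi * d) * Fav (level Q m)"
  proof -
    have "ennreal (1 / (pi * d)) * ennreal (2 * A * d\<^sup>2) = ennreal (2 * A / pi * d)"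
      using d A_nonneg by (subst ennreal_mult[symmetric]) (auto simp: power2_eq_square)
    then show ?thesis by (simp add: mult.assoc[symmetric])
  qed
  ultimately show ?thesis by (simp add: d_def)
qed

text \<open>The \<open>L ^ m\<close> cells contribute a multiple of \<open>mesh m\<close> each, and
  these two factors cancel.\<close>

theorem circles_level_le_Fav:
  assumes "m \<le> j"
  shows "emeasure lebesgue (\<Union>x\<in>level Q (m + j). sphere x (r x)) \<le> ennreal (2 * A / pi) * Fav (level Q m)"
proof -
  have "(\<Union>x\<in>level Q (m + j). sphere x (r x)) = (\<Union>w\<in>words m. circles w j)"
    by (auto simp: level_add circles_def)
  then have "emeasure lebesgue (\<Union>x\<in>level Q (m + j). sphere x (r x)) \<le> (\<Sum>w\<in>words m. emeasure lebesgue (circles w j))"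
    using compact_circles by (auto intro!: emeasure_subadditive_finite simp: compact_imp_closed)
  also have "\<dots> \<le> (\<Sum>w\<in>words m. ennreal (2 * A / pi * mesh m) * Fav (level Q m))"
    using assms by (intro sum_mono circles_le_Fav)
  also have "\<dots> = ennreal (real L ^ m) * (ennreal (2 * A / pi * mesh m) * Fav (level Q m))"
    by (simp add: card_words ennreal_of_nat_eq_real_of_nat)
  also have "\<dots> = ennreal (2 * A / pi) * Fav (level Q m)"
  proof -
    have "real L ^ m * (2 * A / pi * mesh m) = 2 * A / pi"
      using mesh_mult_power[of m] by (metis mult.left_commute mult.right_neutral)
    then have "ennreal (real L ^ m) * ennreal (2 * A / pi * mesh m) = ennreal (2 * A / pi)"
      using A_nonneg by (subst ennreal_mult[symmetric]) auto
    then show ?thesis by (simp add: mult.assoc[symmetric])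
  qed
  finally show ?thesis .
qed

end

section \<open>Null projections of the attractor\<close>

text \<open>Removing the hole leaves two intervals of total length at most
  \<open>(1 - q) * s\<close>, to which the hypothesis applies again; iteration gives the bound
  \<open>(1 - q) ^ n * s\<close> for every \<open>n\<close>.\<close>

lemma porous_null:
  fixes P :: "real set"
  assumes P: "P \<in> sets lebesgue" and s0: "0 < s\<^sub>0" and q: "0 < q"
    and hole: "\<And>\<alpha> s. 0 < s \<Longrightarrow> s \<le> s\<^sub>0 \<Longrightarrow> \<exists>\<beta>. {\<beta>..\<beta> + q * s} \<subseteq> {\<alpha>..\<alpha> + s} - P"
  shows "P \<in> null_sets lebesgue"
proof -
  have q1: "q \<le> 1"
  proof -
    obtain \<beta> where "{\<beta>..\<beta> + q * s\<^sub>0} \<subseteq> {0..0 + s\<^sub>0}" using hole[of s\<^sub>0 0] s0 by blast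
    moreover have "\<beta> \<le> \<beta> + q * s\<^sub>0" using s0 q by simp
    ultimately have "0 \<le> \<beta>" "\<beta> + q * s\<^sub>0 \<le> s\<^sub>0" by auto
    then have "q * s\<^sub>0 \<le> s\<^sub>0" by linarith
    then show ?thesis using mult_right_le_imp_le[of q s\<^sub>0 1] s0 by simp
  qed
  have meas: "P \<inter> {x..y} \<in> lmeasurable" for x y :: real
    using P by (subst Int_commute) (intro fmeasurable_Int_fmeasurable, auto)
  have bound: "measure lebesgue (P \<inter> {\<alpha>..\<alpha> + s}) \<le> (1 - q) ^ n * s" if "0 \<le> s" "s \<le> s\<^sub>0" for n \<alpha> s
    using that
  proof (induction n arbitrary: \<alpha> s)
    case 0
    have "measure lebesgue (P \<inter> {\<alpha>..\<alpha> + s}) \<le> measure lebesgue {\<alpha>..\<alpha> + s}"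
      using P by (intro measure_mono_fmeasurable) auto
    then show ?case using 0 by simp
  next
    case (Suc n)
    show ?case
    \<comment> \<open>A hole at an end of the interval leaves a remainder of length zero, so the
      induction has to admit it.\<close>
    proof (cases "s = 0")
      case True
      have "measure lebesgue (P \<inter> {\<alpha>}) \<le> measure lebesgue {\<alpha>}"
        using P by (intro measure_mono_fmeasurable lmeasurable_compact) auto
      then show ?thesis using True by simp
    next
      case False
      then obtain \<beta> where \<beta>: "{\<beta>..\<beta> + q * s} \<subseteq> {\<alpha>..\<alpha> + s} - P" using hole Suc.prems by force
      have qs: "0 \<le> q * s" using q Suc.prems by simp
      then have b: "\<alpha> \<le> \<beta>" "\<beta> + q * s \<le> \<alpha> + s"
        using subsetD[OF \<beta>, of \<beta>] subsetD[OF \<beta>, of "\<beta> + q * s"] by auto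
      have "P \<inter> {\<alpha>..\<alpha> + s} \<subseteq> (P \<inter> {\<alpha>..\<beta>}) \<union> (P \<inter> {\<beta> + q * s..\<alpha> + s})"
      proof
        fix x assume x: "x \<in> P \<inter> {\<alpha>..\<alpha> + s}"
        then have "x \<notin> {\<beta>..\<beta> + q * s}" using \<beta> by blast
        then show "x \<in> (P \<inter> {\<alpha>..\<beta>}) \<union> (P \<inter> {\<beta> + q * s..\<alpha> + s})" using x by auto
      qed
      then have "measure lebesgue (P \<inter> {\<alpha>..\<alpha> + s}) \<le> measure lebesgue ((P \<inter> {\<alpha>..\<beta>}) \<union> (P \<inter> {\<beta> + q * s..\<alpha> + s}))"
        using meas by (intro measure_mono_fmeasurable) (auto intro: fmeasurableD)
      also have "\<dots> \<le> measure lebesgue (P \<inter> {\<alpha>..\<beta>}) + measure lebesgue (P \<inter> {\<beta> + q * s..\<alpha> + s})"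
        using meas by (intro measure_Un_le) (auto intro: fmeasurableD)
      also have "\<dots> \<le> (1 - q) ^ n * (\<beta> - \<alpha>) + (1 - q) ^ n * (\<alpha> + s - (\<beta> + q * s))"
        using Suc.IH[of "\<beta> - \<alpha>" \<alpha>] Suc.IH[of "\<alpha> + s - (\<beta> + q * s)" "\<beta> + q * s"] b qs Suc.prems by (intro add_mono) auto
      also have "\<dots> = (1 - q) ^ Suc n * s" by (simp add: algebra_simps)
      finally show ?thesis .
    qed
  qed
  have null: "P \<inter> {\<alpha>..\<alpha> + s\<^sub>0} \<in> null_sets lebesgue" for \<alpha>
  proof -
    have "(\<lambda>n. (1 - q) ^ n * s\<^sub>0) \<longlonglongrightarrow> 0 * s\<^sub>0"
      using q q1 by (intro tendsto_mult LIMSEQ_power_zero tendsto_const) auto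
    then have "measure lebesgue (P \<inter> {\<alpha>..\<alpha> + s\<^sub>0}) \<le> 0 * s\<^sub>0"
      by (rule LIMSEQ_le_const) (use bound[of s\<^sub>0 \<alpha>] s0 in auto)
    then have "measure lebesgue (P \<inter> {\<alpha>..\<alpha> + s\<^sub>0}) = 0" by (simp add: measure_le_0_iff)
    then show ?thesis using meas by (simp add: null_sets_def emeasure_eq_measure2 fmeasurableD)
  qed
  have "P = (\<Union>k::int. P \<inter> {of_int k * s\<^sub>0..of_int k * s\<^sub>0 + s\<^sub>0})"
  proof (intro equalityI subsetI)
    fix x assume x: "x \<in> P"
    define k where "k = \<lfloor>x / s\<^sub>0\<rfloor>"
    have "of_int k \<le> x / s\<^sub>0" "x / s\<^sub>0 \<le> of_int k + 1" unfolding k_def by linarith+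
    then have "x \<in> {of_int k * s\<^sub>0..of_int k * s\<^sub>0 + s\<^sub>0}" using s0 by (simp add: field_simps)
    then show "x \<in> (\<Union>k::int. P \<inter> {of_int k * s\<^sub>0..of_int k * s\<^sub>0 + s\<^sub>0})" using x by blast
  qed auto
  also have "\<dots> \<in> null_sets lebesgue" by (intro null_sets_UN null)
  finally show ?thesis .
qed

section \<open>Self-similar sets on the line\<close>

lemma measure_affine_real: "measure lebesgue ((\<lambda>x::real. d * x + t) ` S) = \<bar>d\<bar> * measure lebesgue S"
  using measure_lebesgue_affine[of d t S] by simp

text \<open>If the pieces were separated, \<open>L\<close> disjoint copies of the \<open>\<eta>\<close>-neighbourhood of \<open>A\<close>, scaled by
  \<open>1/L\<close>, would fit into the \<open>\<eta>/L\<close>-neighbourhood, which has strictly smaller measure.\<close>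

lemma linear_ifs_not_separated:
  fixes A :: "real set" and \<beta> :: "nat \<Rightarrow> real"
  assumes A: "compact A" "A \<noteq> {}" and L: "2 \<le> L"
    and fix_A: "A = (\<Union>i\<in>{1..L}. (\<lambda>x. 1 / real L * x + \<beta> i) ` A)"
  obtains i j where "i \<in> {1..L}" "j \<in> {1..L}" "i \<noteq> j"
    "(\<lambda>x. 1 / real L * x + \<beta> i) ` A \<inter> (\<lambda>x. 1 / real L * x + \<beta> j) ` A \<noteq> {}"
proof (rule ccontr)
  assume contra: "\<not> thesis"
  define S where "S i = (\<lambda>x. 1 / real L * x + \<beta> i) ` A" for i
  have disj: "\<And>i j. i \<in> {1..L} \<Longrightarrow> j \<in> {1..L} \<Longrightarrow> i \<noteq> j \<Longrightarrow> S i \<inter> S j = {}"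
    using contra that unfolding S_def by blast
  have cS: "compact (S i)" for i unfolding S_def using A by (intro compact_continuous_image continuous_intros)
  obtain g where g: "0 < g" "\<And>i j x y. i \<in> {1..L} \<Longrightarrow> j \<in> {1..L} \<Longrightarrow> i \<noteq> j \<Longrightarrow> x \<in> S i \<Longrightarrow> y \<in> S j \<Longrightarrow> g \<le> dist x y"
    using compact_family_gap[of "{1..L}" S] cS disj by (metis finite_atLeastAtMost)
  define B where "B \<eta> = {x + y |x y. x \<in> A \<and> y \<in> cball (0::real) \<eta>}" for \<eta>
  have cB: "compact (B \<eta>)" for \<eta> unfolding B_def using A by (intro compact_sums) auto
  then have mB: "B \<eta> \<in> lmeasurable" for \<eta> using lmeasurable_compact by blast
  \<comment> \<open>The scaled neighbourhoods have thickness \<open>\<eta> / L\<close>, so two that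
    meet would bring their pieces within \<open>2 * \<eta> / L\<close>, less than the gap
    \<open>g\<close>.\<close>
  define \<eta> where "\<eta> = g / 2"
  have \<eta>: "0 < \<eta>" using g by (simp add: \<eta>_def)
  have Lp: "0 < real L" "1 < real L" using L by auto
  have near: "\<exists>s\<in>S i. \<bar>z - s\<bar> \<le> \<eta> / L" if "z \<in> (\<lambda>x. 1 / real L * x + \<beta> i) ` B \<eta>" for z i
  proof -
    obtain x y where xy: "x \<in> A" "\<bar>y\<bar> \<le> \<eta>" "z = 1 / real L * (x + y) + \<beta> i" using \<open>z \<in> _\<close> by (auto simp: B_def)
    have "z - (1 / real L * x + \<beta> i) = y / L" unfolding xy by (simp add: add_divide_distrib)
    then show ?thesis using xy Lp by (intro bexI[of _ "1 / real L * x + \<beta> i"]) (auto simp: S_def divide_right_mono)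
  qed
  have "(\<lambda>x. 1 / real L * x + \<beta> i) ` B \<eta> \<inter> (\<lambda>x. 1 / real L * x + \<beta> j) ` B \<eta> = {}" if ij: "i \<in> {1..L}" "j \<in> {1..L}" "i \<noteq> j" for i j
  proof (rule ccontr)
    assume "\<not> ?thesis"
    then obtain z where z: "z \<in> (\<lambda>x. 1 / real L * x + \<beta> i) ` B \<eta>" "z \<in> (\<lambda>x. 1 / real L * x + \<beta> j) ` B \<eta>" by blast
    obtain s s' where s: "s \<in> S i" "\<bar>z - s\<bar> \<le> \<eta> / L" and s': "s' \<in> S j" "\<bar>z - s'\<bar> \<le> \<eta> / L"
      using near[OF z(1)] near[OF z(2)] by blast
    have "\<eta> / L < \<eta> / 1" using \<eta> Lp by (intro divide_strict_left_mono) auto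
    then have "dist s s' < g" using s(2) s'(2) by (simp add: dist_real_def \<eta>_def)
    then show False using g(2)[OF ij s(1) s'(1)] by simp
  qed
  then have djf: "disjoint_family_on (\<lambda>i. (\<lambda>x. 1 / real L * x + \<beta> i) ` B \<eta>) {1..L}" by (auto simp: disjoint_family_on_def)
  have im: "(\<lambda>x. 1 / real L * x + \<beta> i) ` B \<eta> \<in> lmeasurable" for i
    by (intro lmeasurable_compact compact_continuous_image continuous_intros cB)
  have "measure lebesgue (\<Union>i\<in>{1..L}. (\<lambda>x. 1 / real L * x + \<beta> i) ` B \<eta>) = (\<Sum>i\<in>{1..L}. measure lebesgue ((\<lambda>x. 1 / real L * x + \<beta> i) ` B \<eta>))"
  proof (intro measure_finite_Union djf)
    show "(\<lambda>i. (\<lambda>x. 1 / real L * x + \<beta> i) ` B \<eta>) ` {1..L} \<subseteq> sets lebesgue" using im by (blast intro: fmeasurableD)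
    show "emeasure lebesgue ((\<lambda>x. 1 / real L * x + \<beta> i) ` B \<eta>) \<noteq> \<infinity>" for i
      unfolding infinity_ennreal_def by (rule fmeasurableD2[OF im])
  qed simp
  also have "\<dots> = measure lebesgue (B \<eta>)" unfolding measure_affine_real using Lp by simp
  finally have 1: "measure lebesgue (\<Union>i\<in>{1..L}. (\<lambda>x. 1 / real L * x + \<beta> i) ` B \<eta>) = measure lebesgue (B \<eta>)" .
  have sub: "(\<Union>i\<in>{1..L}. (\<lambda>x. 1 / real L * x + \<beta> i) ` B \<eta>) \<subseteq> B (\<eta> / L)"
  proof
    fix z assume "z \<in> (\<Union>i\<in>{1..L}. (\<lambda>x. 1 / real L * x + \<beta> i) ` B \<eta>)"
    then obtain i s where i: "i \<in> {1..L}" "s \<in> S i" "\<bar>z - s\<bar> \<le> \<eta> / L" using near by blast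
    have "s \<in> A" by (subst fix_A) (use i in \<open>auto simp: S_def\<close>)
    then show "z \<in> B (\<eta> / L)" unfolding B_def using i by (intro CollectI exI[of _ s] exI[of _ "z - s"]) auto
  qed
  have "measure lebesgue (B \<eta>) \<le> measure lebesgue (B (\<eta> / L))"
    unfolding 1[symmetric] using im by (intro measure_mono_fmeasurable sub mB sets.finite_UN) (auto intro: fmeasurableD)
  moreover have "measure lebesgue (B (\<eta> / L)) + (\<eta> - \<eta> / L) \<le> measure lebesgue (B \<eta>)"
  proof -
    have lt: "\<eta> / L < \<eta>" using \<eta> Lp divide_strict_left_mono[of 1 "real L" \<eta>] by simp
    \<comment> \<open>Beyond the maximum \<open>z\<close> of \<open>A\<close>, the wider
      neighbourhood gains the interval from \<open>z + \<eta> / L\<close> to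
      \<open>z + \<eta>\<close>, which makes the inequality strict even if \<open>A\<close> is
      null.\<close>
    obtain z where z: "z \<in> A" "\<And>x. x \<in> A \<Longrightarrow> x \<le> z" using compact_attains_sup[OF A] by blast
    have le: "x \<le> z + \<eta> / L" if "x \<in> B (\<eta> / L)" for x
      using that z(2) unfolding B_def by (fastforce intro: add_mono)
    have "B (\<eta> / L) \<inter> {z + \<eta> / L<..z + \<eta>} = {}" using le by fastforce
    then have "measure lebesgue (B (\<eta> / L) \<union> {z + \<eta> / L<..z + \<eta>}) = measure lebesgue (B (\<eta> / L)) + measure lebesgue {z + \<eta> / L<..z + \<eta>}"
      using mB by (subst measure_Un2) (auto intro!: bounded_set_imp_lmeasurable simp: Diff_triv Int_commute bounded_subset_cbox_symmetric compact_imp_bounded[OF cB])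
    moreover have "measure lebesgue {z + \<eta> / L<..z + \<eta>} = \<eta> - \<eta> / L" using lt by simp
    moreover have "measure lebesgue (B (\<eta> / L) \<union> {z + \<eta> / L<..z + \<eta>}) \<le> measure lebesgue (B \<eta>)"
    proof (intro measure_mono_fmeasurable mB)
      show "B (\<eta> / L) \<union> {z + \<eta> / L<..z + \<eta>} \<subseteq> B \<eta>"
      proof
        fix x assume "x \<in> B (\<eta> / L) \<union> {z + \<eta> / L<..z + \<eta>}"
        then show "x \<in> B \<eta>"
        proof
          assume "x \<in> B (\<eta> / L)"
          then show ?thesis using lt by (fastforce simp: B_def)
        next
          assume "x \<in> {z + \<eta> / L<..z + \<eta>}"
          moreover have "0 \<le> \<eta> / L" using \<eta> by simp
          ultimately show ?thesis unfolding B_def using z(1) by (intro CollectI exI[of _ z] exI[of _ "x - z"]) auto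
        qed
      qed
    qed (use mB in \<open>auto intro: fmeasurableD\<close>)
    ultimately show ?thesis by linarith
  qed
  moreover have "\<eta> / L < \<eta>" using \<eta> Lp divide_strict_left_mono[of 1 "real L" \<eta>] by simp
  ultimately show False by linarith
qed

text \<open>Two nearly coinciding pieces overlap almost completely, which contradicts that the pieces
  just suffice to fill \<open>A\<close>.\<close>

lemma overlapping_pieces_null:
  fixes A :: "real set"
  assumes A: "compact A"
    and overlap: "\<And>\<epsilon>. 0 < \<epsilon> \<Longrightarrow> \<exists>(W :: 'i set) \<delta> t. finite W \<and> 0 < \<delta> \<and> real (card W) * \<delta> = 1 \<and>
      A \<subseteq> (\<Union>w\<in>W. (\<lambda>x. \<delta> * x + t w) ` A) \<and> (\<exists>w\<in>W. \<exists>w'\<in>W. w \<noteq> w' \<and> \<bar>t w - t w'\<bar> < \<epsilon> * \<delta>)"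
  shows "emeasure lebesgue A = 0"
proof -
  have mA: "A \<in> lmeasurable" using A lmeasurable_compact by blast
  have "measure lebesgue A = 0"
  proof (rule ccontr)
    assume "measure lebesgue A \<noteq> 0"
    then have pos: "0 < measure lebesgue A" by (simp add: zero_less_measure_iff)
    \<comment> \<open>Outer regularity gives a neighbourhood \<open>U\<close> of \<open>A\<close>
      with less than twice the measure of \<open>A\<close>, so two copies of \<open>A\<close> inside
      one copy of \<open>U\<close> must overlap substantially.\<close>
    obtain V where V: "open V" "A \<subseteq> V" "V - A \<in> lmeasurable" "emeasure lebesgue (V - A) < ennreal (measure lebesgue A)"
      using sets_lebesgue_outer_open[of A "measure lebesgue A"] mA pos by (auto intro: fmeasurableD)
    obtain e' where e': "0 < e'" "(\<Union>x\<in>A. ball x e') \<subseteq> V"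
      using compact_subset_open_imp_ball_epsilon_subset[OF A V(1,2)] by blast
    define e where "e = e' / 2"
    have e: "0 < e" using e' by (simp add: e_def)
    define U where "U = {x + y |x y. x \<in> A \<and> y \<in> cball (0::real) e}"
    have cU: "compact U" unfolding U_def using A by (intro compact_sums) auto
    have UV: "U \<subseteq> V" using e' by (fastforce simp: U_def e_def dist_real_def)
    have AU: "A \<subseteq> U" using e by (force simp: U_def)
    have U: "measure lebesgue U < 2 * measure lebesgue A"
    proof -
      have "V = A \<union> (V - A)" using V(2) by blast
      then have "measure lebesgue U \<le> measure lebesgue (A \<union> (V - A))"
        using UV cU mA V(3) by (intro measure_mono_fmeasurable fmeasurable.Un) (auto simp: compact_imp_closed)
      also have "\<dots> \<le> measure lebesgue A + measure lebesgue (V - A)"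
        using mA V(3) by (intro measure_Un_le) (auto intro: fmeasurableD)
      also have "measure lebesgue (V - A) < measure lebesgue A"
        using V(3,4) by (simp add: emeasure_eq_measure2 ennreal_less_iff)
      finally show ?thesis by simp
    qed
    obtain W :: "'i set" and \<delta> t w w' where W: "finite W" "0 < \<delta>" "real (card W) * \<delta> = 1"
      "A \<subseteq> (\<Union>w\<in>W. (\<lambda>x. \<delta> * x + t w) ` A)" "w \<in> W" "w' \<in> W" "w \<noteq> w'" "\<bar>t w - t w'\<bar> < e * \<delta>"
      using overlap[OF e] by blast
    let ?S = "\<lambda>w. (\<lambda>x. \<delta> * x + t w) ` A"
    have mS: "?S v \<in> lmeasurable" for v by (intro lmeasurable_compact compact_continuous_image continuous_intros A)
    have mU: "(\<lambda>x. \<delta> * x + t w) ` U \<in> lmeasurable"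
      by (intro lmeasurable_compact compact_continuous_image continuous_intros cU)
    \<comment> \<open>After rescaling by \<open>1 / \<delta>\<close> the two copies are offset by
      less than \<open>e\<close>, the radius of \<open>U\<close>.\<close>
    have "?S w \<union> ?S w' \<subseteq> (\<lambda>x. \<delta> * x + t w) ` U"
    proof -
      have "\<delta> * x + t w' \<in> (\<lambda>x. \<delta> * x + t w) ` U" if x: "x \<in> A" for x
      proof -
        have "\<delta> * x + t w' = \<delta> * (x + (t w' - t w) / \<delta>) + t w" using W(2) by (simp add: field_simps)
        moreover have "\<bar>(t w' - t w) / \<delta>\<bar> < e" using W(2,8) by (simp add: abs_divide pos_divide_less_eq abs_minus_commute)
        then have "x + (t w' - t w) / \<delta> \<in> U" unfolding U_def using x
          by (intro CollectI exI[of _ x] exI[of _ "(t w' - t w) / \<delta>"]) simp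
        ultimately show ?thesis by blast
      qed
      then show ?thesis using AU by blast
    qed
    then have "measure lebesgue (?S w \<union> ?S w') \<le> measure lebesgue ((\<lambda>x. \<delta> * x + t w) ` U)"
      using mS mU by (intro measure_mono_fmeasurable) (auto intro: fmeasurableD)
    also have "\<dots> = \<delta> * measure lebesgue U" unfolding measure_affine_real using W(2) by simp
    also have "\<dots> < \<delta> * (2 * measure lebesgue A)" using W(2) U by simp
    finally have two: "measure lebesgue (?S w \<union> ?S w') < \<delta> * (2 * measure lebesgue A)" .
    have fin: "finite (W - {w, w'})" using W(1) by simp
    have "card (W - {w, w'}) + 2 = card W"
    proof -
      have "card {w, w'} = 2" using W(7) by simp
      moreover have "card (W - {w, w'}) + card {w, w'} = card W"
        using W by (metis (no_types, lifting) card_Diff_subset card_mono empty_subsetI finite.emptyI finite_insert insert_subset le_add_diff_inverse2)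
      ultimately show ?thesis by simp
    qed
    then have card: "real (card (W - {w, w'})) = real (card W) - 2" by linarith
    have "A \<subseteq> (?S w \<union> ?S w') \<union> (\<Union>v\<in>W - {w, w'}. ?S v)" using W(4) by blast
    then have "measure lebesgue A \<le> measure lebesgue ((?S w \<union> ?S w') \<union> (\<Union>v\<in>W - {w, w'}. ?S v))"
      using mS mA fin by (intro measure_mono_fmeasurable fmeasurable.Un fmeasurable.finite_UN) (auto intro: fmeasurableD)
    also have "\<dots> \<le> measure lebesgue (?S w \<union> ?S w') + measure lebesgue (\<Union>v\<in>W - {w, w'}. ?S v)"
      using mS fin by (intro measure_Un_le sets.Un sets.finite_UN) (auto intro: fmeasurableD)
    also have "measure lebesgue (\<Union>v\<in>W - {w, w'}. ?S v) \<le> (\<Sum>v\<in>W - {w, w'}. measure lebesgue (?S v))"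
      using mS fin by (intro measure_UNION_le) (auto intro: fmeasurableD)
    also have "\<dots> = (real (card W) - 2) * (\<delta> * measure lebesgue A)"
      unfolding measure_affine_real sum_constant card using W(2) by simp
    \<comment> \<open>The copies have total measure exactly that of \<open>A\<close>, and the union
      of the pair falls short of its share, so they cannot cover \<open>A\<close>.\<close>
    finally have "measure lebesgue A < \<delta> * (2 * measure lebesgue A) + (real (card W) - 2) * (\<delta> * measure lebesgue A)"
      using two by linarith
    also have "\<dots> = (real (card W) * \<delta>) * measure lebesgue A" by (simp add: algebra_simps)
    finally show False using W(3) by simp
  qed
  then show ?thesis using mA by (simp add: emeasure_eq_measure2)
qed

text \<open>If the projection of \<open>d\<close> is at most half its length, the orthogonal
  component is at least half, so the projection changes at a definite rate and a rotation by a
  comparable angle kills it.\<close>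

lemma rotate_to_kernel:
  fixes d :: "real^2"
  assumes f: "\<bar>proj \<theta> d\<bar> \<le> norm d / 2" and d: "d \<noteq> 0"
  obtains \<theta>' where "proj \<theta>' d = 0" "\<bar>\<theta>' - \<theta>\<bar> \<le> 2 * \<bar>proj \<theta> d\<bar> / norm d"
proof -
  \<comment> \<open>Both the derivative of \<open>proj \<theta> d\<close> in \<open>\<theta>\<close>
    and the component of \<open>d\<close> orthogonal to \<open>dir \<theta>\<close>.\<close>
  define g where "g = d$2 * cos \<theta> - d$1 * sin \<theta>"
  have "(proj \<theta> d)\<^sup>2 + g\<^sup>2 = ((d$1)\<^sup>2 + (d$2)\<^sup>2) * ((cos \<theta>)\<^sup>2 + (sin \<theta>)\<^sup>2)"
    unfolding proj_def g_def by algebra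
  then have sq: "(proj \<theta> d)\<^sup>2 + g\<^sup>2 = (norm d)\<^sup>2" by (simp add: norm_2_sq)
  have n: "0 < norm d" using d by simp
  have "(proj \<theta> d)\<^sup>2 \<le> (norm d / 2)\<^sup>2" using power_mono[OF f, of 2] by simp
  then have "4 * (proj \<theta> d)\<^sup>2 \<le> (norm d)\<^sup>2" by (simp add: power_divide)
  then have "(norm d)\<^sup>2 \<le> 4 * g\<^sup>2" using sq zero_le_power2[of "norm d"] by linarith
  then have "(norm d / 2)\<^sup>2 \<le> g\<^sup>2" by (simp add: power_divide)
  then have g: "norm d / 2 \<le> \<bar>g\<bar>" using n by (simp add: abs_le_square_iff[symmetric])
  then have g0: "g \<noteq> 0" using n by auto
  define \<tau> where "\<tau> = arctan (- proj \<theta> d / g)"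
  have ct: "cos \<tau> \<noteq> 0" by (simp add: \<tau>_def)
  have "tan \<tau> = - proj \<theta> d / g" by (simp add: \<tau>_def tan_arctan)
  then have st: "sin \<tau> * g = - proj \<theta> d * cos \<tau>" using ct g0 by (simp add: tan_def field_simps)
  have "proj (\<theta> + \<tau>) d = proj \<theta> d * cos \<tau> + g * sin \<tau>"
    by (simp add: proj_def g_def cos_add sin_add algebra_simps)
  then have "proj (\<theta> + \<tau>) d = 0" using st by (simp add: mult.commute)
  moreover have "\<bar>\<tau>\<bar> \<le> \<bar>- proj \<theta> d / g\<bar>" unfolding \<tau>_def by (rule abs_arctan_le)
  then have "\<bar>\<tau>\<bar> \<le> \<bar>proj \<theta> d\<bar> / \<bar>g\<bar>" by simp
  then have "\<bar>\<tau>\<bar> \<le> \<bar>proj \<theta> d\<bar> / (norm d / 2)"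
    using g n by (smt (verit) divide_left_mono abs_ge_zero half_gt_zero mult_pos_pos)
  ultimately show ?thesis using that[of "\<theta> + \<tau>"] by (simp add: mult.commute)
qed

section \<open>Directions in which the pieces stay apart\<close>

locale separated_ifs = homothetic_ifs +
  fixes E :: "(real^2) set"
  assumes E: "E \<noteq> {}" "compact E" "E = (\<Union>i\<in>{1..L}. contr L b i ` E)"
    and sep: "\<And>i j. i \<in> {1..L} \<Longrightarrow> j \<in> {1..L} \<Longrightarrow> i \<noteq> j \<Longrightarrow> contr L b i ` E \<inter> contr L b j ` E = {}"
begin

lemma proj_contr_image: "proj \<theta> ` contr L b i ` E = (\<lambda>x. 1 / real L * x + proj \<theta> (b i)) ` proj \<theta> ` E"
  by (simp add: image_image contr_def proj_add proj_scale)

text \<open>The projection of \<open>E\<close> is the attractor of \<open>L\<close> maps of ratio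
  \<open>1 / L\<close> on the line, so its pieces cannot be separated, although those of
  \<open>E\<close> are.\<close>

lemma proj_pieces_meet:
  obtains i j x y where "i \<in> {1..L}" "j \<in> {1..L}" "i \<noteq> j" "x \<in> contr L b i ` E" "y \<in> contr L b j ` E" "proj \<theta> x = proj \<theta> y"
proof -
  have fixp: "proj \<theta> ` E = (\<Union>i\<in>{1..L}. (\<lambda>x. 1 / real L * x + proj \<theta> (b i)) ` proj \<theta> ` E)"
  proof -
    have "proj \<theta> ` E = proj \<theta> ` (\<Union>i\<in>{1..L}. contr L b i ` E)" using E(3) by simp
    then show ?thesis by (simp only: image_UN proj_contr_image)
  qed
  obtain i j where "i \<in> {1..L}" "j \<in> {1..L}" "i \<noteq> j"
    "(\<lambda>x. 1 / real L * x + proj \<theta> (b i)) ` proj \<theta> ` E \<inter> (\<lambda>x. 1 / real L * x + proj \<theta> (b j)) ` proj \<theta> ` E \<noteq> {}"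
    using linear_ifs_not_separated[OF compact_proj_image[OF E(2)] _ L2 fixp] E(1) by blast
  then show ?thesis using that unfolding proj_contr_image[symmetric] by blast
qed

text \<open>The directions that keep all pieces of each level apart. Any other direction lets some pair of
  pieces nearly coincide, so its projection is null by \<open>overlapping_pieces_null\<close>.\<close>

definition spread :: "real \<Rightarrow> real set" where
  "spread \<epsilon> = {\<theta>. \<forall>m. \<forall>w\<in>words m. \<forall>w'\<in>words m. w \<noteq> w' \<longrightarrow> \<epsilon> * mesh m \<le> \<bar>proj \<theta> (base w - base w')\<bar>}"

lemma closed_spread: "closed (spread \<epsilon>)"
proof -
  have "spread \<epsilon> = (\<Inter>m. \<Inter>w\<in>words m. \<Inter>w'\<in>words m. {\<theta>. w \<noteq> w' \<longrightarrow> \<epsilon> * mesh m \<le> \<bar>proj \<theta> (base w - base w')\<bar>})"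
    by (auto simp: spread_def)
  also have "closed \<dots>"
    unfolding proj_def by (intro closed_INT ballI closed_Collect_imp open_Collect_const closed_Collect_le continuous_intros)
  finally show ?thesis .
qed

lemma proj_null_of_not_spread:
  assumes "\<And>\<epsilon>. 0 < \<epsilon> \<Longrightarrow> \<theta> \<notin> spread \<epsilon>"
  shows "emeasure lebesgue (proj \<theta> ` E) = 0"
proof (rule overlapping_pieces_null[where 'i="nat list"])
  show "compact (proj \<theta> ` E)" using E(2) by (rule compact_proj_image)
  fix \<epsilon> :: real assume "0 < \<epsilon>"
  then obtain m w w' where w: "w \<in> words m" "w' \<in> words m" "w \<noteq> w'" "\<bar>proj \<theta> (base w) - proj \<theta> (base w')\<bar> < \<epsilon> * mesh m"
    using assms[of \<epsilon>] by (auto simp: spread_def not_le proj_diff)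
  have "proj \<theta> ` E = (\<Union>w\<in>words m. (\<lambda>x. mesh m * x + proj \<theta> (base w)) ` proj \<theta> ` E)"
  proof -
    have "proj \<theta> ` E = proj \<theta> ` level E m" using level_fixed[OF E(3)] by simp
    also have "\<dots> = (\<Union>w\<in>words m. (\<lambda>x. mesh m * x + proj \<theta> (base w)) ` proj \<theta> ` E)"
      unfolding level_def image_UN
      by (intro SUP_cong refl) (simp add: image_image cell_def proj_add proj_scale length_words)
    finally show ?thesis .
  qed
  then show "\<exists>(W :: nat list set) \<delta> t. finite W \<and> 0 < \<delta> \<and> real (card W) * \<delta> = 1 \<and>
      proj \<theta> ` E \<subseteq> (\<Union>w\<in>W. (\<lambda>x. \<delta> * x + t w) ` proj \<theta> ` E) \<and> (\<exists>w\<in>W. \<exists>w'\<in>W. w \<noteq> w' \<and> \<bar>t w - t w'\<bar> < \<epsilon> * \<delta>)"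
    using w mesh_mult_power[of m]
    by (intro exI[of _ "words m"] exI[of _ "mesh m"] exI[of _ "\<lambda>w. proj \<theta> (base w)"] conjI) (auto simp: card_words)
qed

text \<open>Consecutive meshes differ by the factor \<open>L\<close>. A second factor is spent on
  moving to \<open>Suc m\<close>, because the words in \<open>spread_null\<close> need a first
  letter.\<close>

lemma choose_mesh:
  assumes "0 < x" "x \<le> 1"
  obtains m where "mesh (Suc m) \<le> x" "x / real L ^ 2 \<le> mesh (Suc m)"
proof -
  have "eventually (\<lambda>m. mesh m < x) sequentially"
    using mesh_tendsto_0 assms(1) by (rule order_tendstoD)
  then have ex: "\<exists>m. mesh m \<le> x" by (auto simp: eventually_sequentially intro: less_imp_le)
  define m where "m = (LEAST m. mesh m \<le> x)"
  have m: "mesh m \<le> x" unfolding m_def using ex by (rule LeastI_ex)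
  have Lp: "1 \<le> real L" using L2 by simp
  have "x / real L \<le> mesh m"
  proof (cases m)
    case 0
    have "x / real L \<le> 1 / 1" using assms Lp by (intro frac_le) auto
    then show ?thesis using 0 by simp
  next
    case (Suc k)
    then have "\<not> mesh k \<le> x" using not_less_Least[of k "\<lambda>m. mesh m \<le> x"] unfolding m_def by simp
    then show ?thesis using Suc Lp by (simp add: mesh_Suc divide_right_mono)
  qed
  then have "x / real L / real L \<le> mesh (Suc m)" unfolding mesh_Suc using Lp by (intro divide_right_mono) auto
  then show ?thesis using that[of m] order_trans[OF mesh_antimono[of m "Suc m"] m] by (simp add: power2_eq_square)
qed

text \<open>In each direction two first-level pieces meet under the projection, so rotating by an angle of
  order \<open>mesh m\<close> makes two level-\<open>m\<close> pieces coincide, which leaves a proportional hole in \<open>spread \<epsilon>\<close>.\<close>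

lemma spread_null:
  assumes \<epsilon>: "0 < \<epsilon>"
  shows "spread \<epsilon> \<in> null_sets lebesgue"
proof -
  obtain R where R: "1 \<le> R" "E \<subseteq> cball 0 R" "\<And>w m. w \<in> words m \<Longrightarrow> base w \<in> cball 0 R"
    using bounding_radius[OF compact_imp_bounded[OF E(2)]] by metis
  have "compact (contr L b i ` E)" for i unfolding contr_def using E(2) by (intro compact_continuous_image continuous_intros)
  then obtain g where g: "0 < g" "\<And>i j x y. i \<in> {1..L} \<Longrightarrow> j \<in> {1..L} \<Longrightarrow> i \<noteq> j \<Longrightarrow> x \<in> contr L b i ` E \<Longrightarrow> y \<in> contr L b j ` E \<Longrightarrow> g \<le> dist x y"
    using compact_family_gap[of "{1..L}" "\<lambda>i. contr L b i ` E"] sep by (metis finite_atLeastAtMost)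
  \<comment> \<open>In units of \<open>mesh (Suc m)\<close>, the hole will have its centre within
    \<open>8 * R / g\<close> of the middle of the interval and half-length
    \<open>\<epsilon> / (4 * R)\<close>; their sum must fit into half the interval.\<close>
  define C where "C = 8 * R / g + \<epsilon> / (4 * R)"
  have C: "0 < C" using R g \<epsilon> by (simp add: C_def add_pos_pos)
  have Lp: "1 \<le> real L" using L2 by simp
  \<comment> \<open>The hole length \<open>\<epsilon> / (2 * R) * mesh (Suc m)\<close> relative to
    \<open>s\<close>, with the mesh replaced by its lower bound from
    \<open>choose_mesh\<close>.\<close>
  define q where "q = \<epsilon> / (4 * R * C * real L ^ 2)"
  show ?thesis
  proof (rule porous_null)
    show "spread \<epsilon> \<in> sets lebesgue" using closed_spread by auto
    \<comment> \<open>The bound \<open>2 * C\<close> makes \<open>choose_mesh\<close> applicable;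
      the bound 2 yields \<open>8 * R * \<sigma> \<le> g\<close>, which keeps the two corners
      apart.\<close>
    show "0 < min 2 (2 * C)" using C by simp
    show "0 < q" unfolding q_def using \<epsilon> R C Lp by (intro divide_pos_pos mult_pos_pos) auto
    fix \<alpha> s :: real
    assume s: "0 < s" "s \<le> min 2 (2 * C)"
    define \<theta> where "\<theta> = \<alpha> + s / 2"
    obtain m where m: "mesh (Suc m) \<le> s / (2 * C)" "s / (2 * C) / real L ^ 2 \<le> mesh (Suc m)"
      using choose_mesh[of "s / (2 * C)"] s C by (auto simp: field_simps)
    define \<sigma> where "\<sigma> = mesh (Suc m)"
    have \<sigma>: "0 < \<sigma>" by (simp add: \<sigma>_def)
    have C\<sigma>: "8 * R / g * \<sigma> + \<epsilon> / (4 * R) * \<sigma> \<le> s / 2"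
      using m(1) C unfolding C_def[symmetric] distrib_right[symmetric] by (simp add: \<sigma>_def field_simps)
    have "0 \<le> \<epsilon> / (4 * R) * \<sigma>" using \<epsilon> R \<sigma> by simp
    then have "8 * R / g * \<sigma> \<le> 1" using C\<sigma> s(2) by linarith
    then have g8: "8 * R * \<sigma> \<le> g" using g(1) by (simp add: field_simps)
    obtain i j x y where ij: "i \<in> {1..L}" "j \<in> {1..L}" "i \<noteq> j" and xy: "x \<in> contr L b i ` E" "y \<in> contr L b j ` E" "proj \<theta> x = proj \<theta> y"
      by (rule proj_pieces_meet)
    have piece: "\<exists>w\<in>words (Suc m). hd w = i \<and> norm (x - base w) \<le> R * \<sigma>" if i: "i \<in> {1..L}" and x: "x \<in> contr L b i ` E" for i x
    proof -
      obtain z where z: "z \<in> E" "x = contr L b i z" using x by blast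
      have "z \<in> level E m" using z(1) level_fixed[OF E(3), of m] by simp
      then obtain v e where v: "v \<in> words m" "e \<in> E" "x = contr L b i (cell v e)"
        using z(2) unfolding level_def by auto
      then have "x - base (i # v) = \<sigma> *\<^sub>R e"
        using cell_def[of "i # v" e] by (simp add: cell_Cons[symmetric] \<sigma>_def length_words del: base.simps)
      then have "norm (x - base (i # v)) \<le> R * \<sigma>" using v(2) R(2) \<sigma> by (auto simp: mult.commute intro!: mult_right_mono)
      then show ?thesis using i v(1) by (intro bexI[of _ "i # v"]) (auto simp: words_def)
    qed
    obtain w w' where w: "w \<in> words (Suc m)" "hd w = i" "norm (x - base w) \<le> R * \<sigma>"
      and w': "w' \<in> words (Suc m)" "hd w' = j" "norm (y - base w') \<le> R * \<sigma>"
      using piece[OF ij(1) xy(1)] piece[OF ij(2) xy(2)] by blast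
    have ww: "w \<noteq> w'" using w w' ij by auto
    define d where "d = base w - base w'"
    have "norm (x - y) \<le> norm d + norm ((x - base w) - (y - base w'))"
      using norm_triangle_ineq[of d "(x - base w) - (y - base w')"] by (simp add: d_def algebra_simps)
    moreover have xyd: "norm ((x - base w) - (y - base w')) \<le> 2 * R * \<sigma>"
      using norm_triangle_ineq4[of "x - base w" "y - base w'"] w w' by linarith
    moreover have "g \<le> norm (x - y)" using g(2)[OF ij xy(1,2)] by (simp add: dist_norm)
    ultimately have dn: "g / 2 \<le> norm d" using g8 g(1) by linarith
    have d2R: "norm d \<le> 2 * R"
      using R(3)[OF w(1)] R(3)[OF w'(1)] norm_triangle_ineq4[of "base w" "base w'"] by (simp add: d_def)
    \<comment> \<open>The two chosen points have the same projection, so only their offsets from the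
      corners contribute.\<close>
    have "proj \<theta> d = - proj \<theta> ((x - base w) - (y - base w'))" using xy(3) by (simp add: d_def proj_diff)
    then have pd: "\<bar>proj \<theta> d\<bar> \<le> 2 * R * \<sigma>" using abs_proj_le xyd by (metis abs_minus order_trans)
    then have "\<bar>proj \<theta> d\<bar> \<le> norm d / 2" using dn g8 by linarith
    moreover have "d \<noteq> 0" using dn g(1) by auto
    ultimately obtain \<theta>' where \<theta>': "proj \<theta>' d = 0" "\<bar>\<theta>' - \<theta>\<bar> \<le> 2 * \<bar>proj \<theta> d\<bar> / norm d"
      using rotate_to_kernel[of \<theta> d] \<open>d \<noteq> 0\<close> by blast
    have "2 * \<bar>proj \<theta> d\<bar> / norm d \<le> 2 * (2 * R * \<sigma>) / (g / 2)"
      using pd dn g(1) R \<sigma> by (intro frac_le) auto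
    then have \<theta>'2: "\<bar>\<theta>' - \<theta>\<bar> \<le> 8 * R / g * \<sigma>" using \<theta>'(2) by simp
    \<comment> \<open>Within \<open>h\<close> of \<open>\<theta>'\<close> the projection of
      \<open>d\<close> is at most \<open>h * (2 * R)\<close>, which is half of
      \<open>\<epsilon> * \<sigma>\<close>.\<close>
    define h where "h = \<epsilon> / (4 * R) * \<sigma>"
    have h: "0 < h" using \<epsilon> R \<sigma> by (simp add: h_def)
    have sub1: "{\<theta>' - h..\<theta>' + h} \<subseteq> {\<alpha>..\<alpha> + s}"
      using \<theta>'2 C\<sigma> unfolding h_def[symmetric] \<theta>_def by (auto simp: abs_le_iff)
    have sub2: "\<phi> \<notin> spread \<epsilon>" if "\<phi> \<in> {\<theta>' - h..\<theta>' + h}" for \<phi>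
    proof -
      have "proj \<phi> d = (dir \<phi> - dir \<theta>') \<bullet> d" using \<theta>'(1) by (simp add: proj_eq_inner inner_diff_left)
      then have "\<bar>proj \<phi> d\<bar> \<le> norm (dir \<phi> - dir \<theta>') * norm d" using Cauchy_Schwarz_ineq2 by metis
      also have "\<dots> \<le> h * (2 * R)"
        using that d2R h by (intro mult_mono order_trans[OF dir_diff_le]) auto
      also have "\<dots> < \<epsilon> * \<sigma>" using R \<epsilon> \<sigma> by (simp add: h_def field_simps)
      finally show ?thesis using w(1) w'(1) ww unfolding spread_def d_def \<sigma>_def by force
    qed
    have "q * s = \<epsilon> / (2 * R) * (s / (2 * C) / real L ^ 2)" by (simp add: q_def)
    also have "\<dots> \<le> \<epsilon> / (2 * R) * \<sigma>" using m(2) \<epsilon> R unfolding \<sigma>_def by (intro mult_left_mono) auto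
    also have "\<dots> = 2 * h" by (simp add: h_def)
    finally have "q * s \<le> 2 * h" .
    then have "{\<theta>' - h..\<theta>' - h + q * s} \<subseteq> {\<theta>' - h..\<theta>' + h}" by auto
    then show "\<exists>\<beta>. {\<beta>..\<beta> + q * s} \<subseteq> {\<alpha>..\<alpha> + s} - spread \<epsilon>" using sub1 sub2 by blast
  qed
qed

text \<open>\<open>spread\<close> grows as its parameter decreases, so the countably many values
  \<open>1 / real (Suc n)\<close> capture every exceptional direction.\<close>

theorem Fav_attractor: "Fav E = 0"
proof -
  let ?f = "\<lambda>\<theta>. emeasure lebesgue (proj \<theta> ` E)"
  have "(\<Union>n. spread (1 / real (Suc n))) \<in> null_sets lebesgue"
    by (intro null_sets_UN spread_null) simp
  \<comment> \<open>Closedness moves the null set from \<open>lebesgue\<close> to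
    \<open>lborel\<close>, the measure in \<open>Fav\<close>.\<close>
  moreover have "(\<Union>n. spread (1 / real (Suc n))) \<in> sets lborel"
    using closed_spread by auto
  ultimately have null: "(\<Union>n. spread (1 / real (Suc n))) \<in> null_sets lborel"
    by (auto simp: null_sets_def)
  have "?f \<theta> = 0" if "\<theta> \<notin> (\<Union>n. spread (1 / real (Suc n)))" for \<theta>
  proof (rule proj_null_of_not_spread)
    fix \<epsilon> :: real assume "0 < \<epsilon>"
    then obtain n where n: "1 / real (Suc n) < \<epsilon>" using nat_approx_posE by metis
    have "spread \<epsilon> \<subseteq> spread (1 / real (Suc n))"
    proof
      fix \<phi> assume "\<phi> \<in> spread \<epsilon>"
      moreover have "1 / real (Suc n) * mesh m \<le> \<epsilon> * mesh m" for m using n by (intro mult_right_mono) auto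
      ultimately show "\<phi> \<in> spread (1 / real (Suc n))" unfolding spread_def by (blast intro: order_trans)
    qed
    then show "\<theta> \<notin> spread \<epsilon>" using that by blast
  qed
  then have "AE \<theta> in lborel. ?f \<theta> * indicator {0..pi} \<theta> = 0"
    by (intro AE_I'[OF null]) auto
  then show ?thesis unfolding Fav_def by (subst nn_integral_0_iff_AE[OF Fav_eq_emeasure(2)[OF E(2)]]) auto
qed

text \<open>Continuity from above for the compact graphs over the angles. They shrink to the graph
  of \<open>E\<close>, since every level-\<open>m\<close> cell of the disc contains a point of
  \<open>E\<close> and has diameter at most \<open>2 * R * mesh m\<close>.\<close>

theorem Fav_level_cball_tendsto_0:
  assumes R: "E \<subseteq> cball 0 R" and dec: "\<And>m. level (cball 0 R) (Suc m) \<subseteq> level (cball 0 R) m"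
  shows "(\<lambda>m. Fav (level (cball 0 R) m)) \<longlonglongrightarrow> 0"
proof -
  let ?W = "\<lambda>F. {(\<theta>, t). \<theta> \<in> {0..pi} \<and> t \<in> proj \<theta> ` F}"
  let ?F = "level (cball 0 R)"
  have cF: "compact (?F m)" for m by (intro compact_level) simp
  have "(\<Inter>m. ?W (?F m)) = ?W E"
  proof (intro equalityI subsetI)
    fix z assume z: "z \<in> (\<Inter>m. ?W (?F m))"
    obtain \<theta> t where zt: "z = (\<theta>, t)" by fastforce
    have \<theta>: "\<theta> \<in> {0..pi}" and t: "\<And>m. t \<in> proj \<theta> ` ?F m" using z zt by auto
    have "\<exists>e\<in>proj \<theta> ` E. \<bar>e - t\<bar> \<le> 2 * R * mesh m" for m
    proof -
      obtain w x where wx: "w \<in> words m" "norm x \<le> R" "t = proj \<theta> (cell w x)" using t[of m] by (auto simp: level_def)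
      obtain e where e: "e \<in> E" "norm e \<le> R" using E(1) R by fastforce
      have "cell w e \<in> E" using level_fixed[OF E(3), of m] wx e unfolding level_def by blast
      moreover have "\<bar>proj \<theta> (cell w e) - t\<bar> \<le> norm (cell w e - cell w x)"
        unfolding wx(3) proj_diff[symmetric] by (rule abs_proj_le)
      moreover have "norm (cell w e - cell w x) \<le> mesh m * (2 * R)"
        unfolding dist_cell length_words[OF wx(1)] using norm_triangle_ineq4[of e x] e wx by (intro mult_left_mono) auto
      ultimately show ?thesis by (force simp: mult_ac)
    qed
    then obtain e where e: "\<And>m. e m \<in> proj \<theta> ` E" "\<And>m. \<bar>e m - t\<bar> \<le> 2 * R * mesh m" by metis
    have "(\<lambda>m. 2 * R * mesh m) \<longlonglongrightarrow> 2 * R * 0" by (intro tendsto_intros mesh_tendsto_0)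
    then have "(\<lambda>m. 2 * R * mesh m) \<longlonglongrightarrow> 0" by simp
    then have "(\<lambda>m. e m - t) \<longlonglongrightarrow> 0" by (rule Lim_null_comparison[rotated]) (use e(2) in auto)
    then have "e \<longlonglongrightarrow> t" by (rule LIM_zero_cancel)
    moreover have "closed (proj \<theta> ` E)" using compact_proj_image[OF E(2)] by (rule compact_imp_closed)
    ultimately have "t \<in> proj \<theta> ` E" using e(1) by (metis closed_sequentially)
    then show "z \<in> ?W E" using \<theta> zt by simp
  next
    fix z assume z: "z \<in> ?W E"
    have "E \<subseteq> ?F m" for m using level_mono[OF R, of m] level_fixed[OF E(3)] by simp
    then show "z \<in> (\<Inter>m. ?W (?F m))" using z by blast
  qed
  moreover have "(\<lambda>m. emeasure lborel (?W (?F m))) \<longlonglongrightarrow> emeasure lborel (\<Inter>m. ?W (?F m))"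
  proof (rule Lim_emeasure_decseq)
    show "range (\<lambda>m. ?W (?F m)) \<subseteq> sets lborel"
      using compact_proj_graph[OF cF] by (auto simp: compact_imp_closed)
    show "decseq (\<lambda>m. ?W (?F m))" using dec by (intro decseq_SucI) blast
    show "emeasure lborel (?W (?F m)) \<noteq> \<infinity>" for m
      using emeasure_compact_finite[OF compact_proj_graph[OF cF, of m]] by (auto simp: less_top)
  qed
  ultimately show ?thesis using Fav_eq_emeasure(1)[OF cF] Fav_eq_emeasure(1)[OF E(2)] Fav_attractor by simp
qed

end

section \<open>Conclusion\<close>

lemma gradient_lipschitz:
  fixes r :: "'a::real_inner \<Rightarrow> real"
  assumes "\<And>x. GDERIV r x :> G x" "\<And>x. norm (G x) \<le> c"
  shows "\<bar>r x - r y\<bar> \<le> c * norm (x - y)"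
proof -
  have "norm (r x - r y) \<le> c * norm (x - y)"
  proof (rule differentiable_bound[of UNIV])
    fix z
    show "(r has_derivative (\<lambda>h. h \<bullet> G z)) (at z within UNIV)" using assms(1) by (simp add: gderiv_def)
    show "onorm (\<lambda>h. h \<bullet> G z) \<le> c"
    proof (rule onorm_bound)
      fix h
      have "norm (h \<bullet> G z) \<le> norm h * norm (G z)" using Cauchy_Schwarz_ineq2[of h "G z"] by simp
      also have "\<dots> \<le> norm h * c" using assms(2) by (intro mult_left_mono) auto
      finally show "norm (h \<bullet> G z) \<le> c * norm h" by (simp add: mult.commute)
    qed (use assms(2) norm_ge_zero order_trans in blast)
  qed auto
  then show ?thesis by simp
qed

text \<open>The second derivative is bounded on balls by compactness, hence a quadratic error that
  is uniform on \<open>cball 0 R\<close>; for this reason all centres are confined to such a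
  ball.\<close>

lemma C2_taylor_bound:
  fixes r :: "real^2 \<Rightarrow> real"
  assumes C2: "C2 r" and G: "\<And>x. GDERIV r x :> G x"
  obtains K where "0 \<le> K" "\<And>x y. x \<in> cball 0 R \<Longrightarrow> y \<in> cball 0 R \<Longrightarrow>
        \<bar>r y - r x - G x \<bullet> (y - x)\<bar> \<le> K * (norm (y - x))\<^sup>2"
proof -
  obtain f' :: "real^2 \<Rightarrow> ((real^2) \<Rightarrow>\<^sub>L real)" and f'' :: "real^2 \<Rightarrow> ((real^2) \<Rightarrow>\<^sub>L ((real^2) \<Rightarrow>\<^sub>L real))"
    where f: "\<And>x. (r has_derivative blinfun_apply (f' x)) (at x)" "\<And>x. (f' has_derivative blinfun_apply (f'' x)) (at x)"
      "continuous_on UNIV f''"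
    using C2 unfolding C2_def by auto
  have fG: "blinfun_apply (f' x) h = G x \<bullet> h" for x h
  proof -
    have "(r has_derivative (\<lambda>h. h \<bullet> G x)) (at x)" using G by (simp add: gderiv_def)
    then have "blinfun_apply (f' x) = (\<lambda>h. h \<bullet> G x)" using f(1) has_derivative_unique by blast
    then show ?thesis by (simp add: inner_commute)
  qed
  have "bounded (f'' ` cball 0 R)"
    by (intro compact_imp_bounded compact_continuous_image continuous_on_subset[OF f(3)]) auto
  then obtain K where K: "0 < K" "\<And>x. x \<in> cball 0 R \<Longrightarrow> norm (f'' x) \<le> K" unfolding bounded_pos by auto
  have lip: "norm (f' x - f' y) \<le> K * norm (x - y)" if "x \<in> cball 0 R" "y \<in> cball 0 R" for x y
  proof (rule differentiable_bound[OF convex_cball _ _ that])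
    fix z :: "real^2" assume "z \<in> cball 0 R"
    then show "(f' has_derivative blinfun_apply (f'' z)) (at z within cball 0 R)" "onorm (blinfun_apply (f'' z)) \<le> K"
      using K(2) f(2) by (auto intro: has_derivative_at_withinI simp: norm_blinfun.rep_eq[symmetric])
  qed
  have "\<bar>r y - r x - G x \<bullet> (y - x)\<bar> \<le> K * (norm (y - x))\<^sup>2" if xy: "x \<in> cball 0 R" "y \<in> cball 0 R" for x y
  proof -
    \<comment> \<open>The derivative of \<open>?\<phi>\<close> at \<open>z\<close> is
      \<open>f' z - f' x\<close>, of norm at most \<open>K * norm (y - x)\<close> on the segment;
      the mean value inequality supplies the second factor.\<close>
    let ?\<phi> = "\<lambda>z. r z - blinfun_apply (f' x) z"
    have "norm (?\<phi> y - ?\<phi> x) \<le> (K * norm (y - x)) * norm (y - x)"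
    proof (rule differentiable_bound[of "closed_segment x y" ?\<phi> "\<lambda>z. blinfun_apply (f' z - f' x)"])
      fix z assume z: "z \<in> closed_segment x y"
      show "(?\<phi> has_derivative blinfun_apply (f' z - f' x)) (at z within closed_segment x y)"
        unfolding minus_blinfun.rep_eq
        by (intro has_derivative_diff has_derivative_at_withinI[OF f(1)] bounded_linear_imp_has_derivative blinfun.bounded_linear_right)
      have "z \<in> cball 0 R" using z xy closed_segment_subset[OF xy convex_cball] by blast
      then have "norm (f' z - f' x) \<le> K * norm (z - x)" using lip xy by blast
      also have "\<dots> \<le> K * norm (y - x)" using segment_bound1[OF z] K(1) by (intro mult_left_mono) (auto simp: norm_minus_commute)
      finally show "onorm (blinfun_apply (f' z - f' x)) \<le> K * norm (y - x)" by (simp add: norm_blinfun.rep_eq)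
    qed auto
    moreover have "?\<phi> y - ?\<phi> x = r y - r x - G x \<bullet> (y - x)" by (simp add: fG inner_diff_right)
    ultimately show ?thesis by (simp add: power2_eq_square mult.assoc)
  qed
  then show ?thesis using that[of K] K(1) by simp
qed

context homothetic_ifs
begin

theorem circles_level_bound:
  fixes r :: "real^2 \<Rightarrow> real"
  assumes r: "0 < a\<^sub>0" "\<And>x. r x \<in> {a\<^sub>0..b\<^sub>0}" "C2 r"
    and G: "\<And>x. GDERIV r x :> G x" "\<And>x. norm (G x) \<le> c" "0 \<le> c" "c < 1"
    and Q: "compact Q" "convex Q" "Q \<noteq> {}" "0 < \<kappa>"
    and thick: "\<And>x v. x \<in> Q \<Longrightarrow> norm v = 1 \<Longrightarrow> \<exists>q\<in>Q. \<kappa> \<le> \<bar>v \<bullet> (q - x)\<bar>"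
  obtains C :: real where "\<And>m j. m \<le> j \<Longrightarrow>
    emeasure lebesgue (\<Union>x\<in>level Q (m + j). sphere x (r x)) \<le> ennreal C * Fav (level Q m)"
proof -
  obtain R where R: "1 \<le> R" "Q \<subseteq> cball 0 R" "\<And>m. level (cball 0 R) m \<subseteq> cball 0 R" "\<And>w m. w \<in> words m \<Longrightarrow> base w \<in> cball 0 R"
    using bounding_radius[OF compact_imp_bounded[OF Q(1)]] by metis
  obtain K where K: "0 \<le> K" "\<And>x y. x \<in> cball 0 R \<Longrightarrow> y \<in> cball 0 R \<Longrightarrow>
        \<bar>r y - r x - G x \<bullet> (y - x)\<bar> \<le> K * (norm (y - x))\<^sup>2"
    using C2_taylor_bound[OF r(3) G(1)] by metis
  interpret circle_bundle L b Q r G \<kappa> R a\<^sub>0 b\<^sub>0 c K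
  proof
    show "level Q m \<subseteq> cball 0 R" for m using level_mono[OF R(2)] R(3) by blast
    show "\<bar>r x - r y\<bar> \<le> norm (x - y)" for x y
    proof -
      have "\<bar>r x - r y\<bar> \<le> c * norm (x - y)" by (rule gradient_lipschitz[OF G(1,2)])
      also have "\<dots> \<le> 1 * norm (x - y)" using G(4) by (intro mult_right_mono) auto
      finally show ?thesis by simp
    qed
  qed (use assms R K in auto)
  show ?thesis using circles_level_le_Fav by (rule that)
qed

end

text \<open>Some coordinate of \<open>v\<close> is at least 1/2 in absolute value, and moving
  \<open>x\<close> along that axis to the farther side covers a distance of at least 1/2.\<close>

lemma unit_square_thick:
  fixes x v :: "real^2"
  assumes x: "x \<in> cbox 0 1" and v: "norm v = 1"
  shows "\<exists>q\<in>cbox 0 1. 1 / 4 \<le> \<bar>v \<bullet> (q - x)\<bar>"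
proof -
  obtain i where i: "1 / 2 \<le> \<bar>v $ i\<bar>"
  proof (cases "1 / 2 \<le> \<bar>v $ 1\<bar>")
    case False
    then have "(v$1)\<^sup>2 \<le> (1/2)\<^sup>2" by (intro abs_le_square_iff[THEN iffD1]) auto
    moreover have "(v$1)\<^sup>2 + (v$2)\<^sup>2 = 1" using norm_2_sq[of v] v by simp
    ultimately have "(1/2)\<^sup>2 \<le> (v$2)\<^sup>2" by (simp add: power_divide)
    then have "\<bar>1/2\<bar> \<le> \<bar>v$2\<bar>" by (simp only: abs_le_square_iff)
    then show ?thesis using that[of 2] by simp
  qed (use that in blast)
  define t where "t = (if 1 / 2 \<le> x $ i then - x $ i else 1 - x $ i)"
  have x01: "0 \<le> x $ k" "x $ k \<le> 1" for k using x by (auto simp: mem_box_cart)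
  have t: "1 / 2 \<le> \<bar>t\<bar>" "0 \<le> x $ i + t" "x $ i + t \<le> 1" using x01[of i] by (auto simp: t_def)
  have "x + t *\<^sub>R axis i 1 \<in> cbox 0 1"
    using x01 t by (auto simp: mem_box_cart axis_def)
  moreover have "1 / 4 \<le> \<bar>v \<bullet> (t *\<^sub>R axis i 1)\<bar>"
    using mult_mono[OF i t(1)] by (simp add: inner_axis abs_mult mult.commute)
  ultimately show ?thesis by (intro bexI[of _ "x + t *\<^sub>R axis i 1"]) simp_all
qed

text \<open>Either \<open>v\<close> or \<open>- v\<close> serves, according to the sign of
  \<open>v \<bullet> x\<close>.\<close>

lemma cball_thick:
  fixes x v :: "'a::real_inner"
  assumes v: "norm v = 1" and R: "1 \<le> R"
  shows "\<exists>q\<in>cball 0 R. 1 \<le> \<bar>v \<bullet> (q - x)\<bar>"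
proof (cases "v \<bullet> x \<le> 0")
  case True
  then show ?thesis using assms by (intro bexI[of _ v]) (auto simp: inner_diff_right power2_norm_eq_inner[symmetric])
next
  case False
  then show ?thesis using assms by (intro bexI[of _ "- v"]) (auto simp: inner_diff_right power2_norm_eq_inner[symmetric])
qed

theorem theorem2p7:
  fixes a\<^sub>0 b\<^sub>0 c :: real
    and r :: "real^2 \<Rightarrow> real"
    and grad_r :: "real^2 \<Rightarrow> real^2"
    and L :: nat
    and b :: "nat \<Rightarrow> real^2"
    and E :: "(real^2) set"
  assumes "0 < a\<^sub>0" and "a\<^sub>0 < b\<^sub>0"
    and "0 \<le> c" and "c < 1"
    and "\<And>x. r x \<in> {a\<^sub>0..b\<^sub>0}"
    and "C2 r"
    and "\<And>x. GDERIV r x :> grad_r x"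
    and "\<And>x. norm (grad_r x) \<le> c"
    and "3 \<le> L"
    and "\<not> collinear (b ` {1..L})"
    and "E \<noteq> {}" and "compact E"
    and "E = (\<Union>i\<in>{1..L}. contr L b i ` E)"
    and "\<And>i j. i \<in> {1..L} \<Longrightarrow> j \<in> {1..L} \<Longrightarrow> i \<noteq> j \<Longrightarrow>
           contr L b i ` E \<inter> contr L b j ` E = {}"
  shows "(\<Union>x\<in>E. sphere x (r x)) \<in> null_sets lebesgue \<and>
    (\<exists>C::real. \<forall>n. emeasure lebesgue (\<Union>x\<in>level_approx L b n. sphere x (r x))
        \<le> ennreal C * Fav (level_approx L b (n div 2)))"
proof
  interpret separated_ifs L b E
    using assms(9,11-14) by unfold_locales auto
  note bound = circles_level_bound[OF assms(1,5,6,7,8,3,4)]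
  obtain C where C: "\<And>m j. m \<le> j \<Longrightarrow>
      emeasure lebesgue (\<Union>x\<in>level (cbox 0 1) (m + j). sphere x (r x)) \<le> ennreal C * Fav (level (cbox 0 1) m)"
    by (rule bound[of "cbox 0 1" "1/4", OF _ _ _ _ unit_square_thick]) (auto simp: interval_ne_empty_cart)
  \<comment> \<open>For either parity \<open>n - n div 2\<close> is at least \<open>n div 2\<close>,
    as the bound requires.\<close>
  have "emeasure lebesgue (\<Union>x\<in>level_approx L b n. sphere x (r x)) \<le> ennreal C * Fav (level_approx L b (n div 2))" for n
    using C[of "n div 2" "n - n div 2"] by (simp add: level_approx_eq_level)
  then show "\<exists>C::real. \<forall>n. emeasure lebesgue (\<Union>x\<in>level_approx L b n. sphere x (r x))
        \<le> ennreal C * Fav (level_approx L b (n div 2))" by blast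
next
  interpret separated_ifs L b E
    using assms(9,11-14) by unfold_locales auto
  note bound = circles_level_bound[OF assms(1,5,6,7,8,3,4)]
  obtain R where R: "1 \<le> R" "E \<subseteq> cball 0 R" "\<And>m. level (cball 0 R) (Suc m) \<subseteq> level (cball 0 R) m"
    using bounding_radius[OF compact_imp_bounded[OF assms(12)]] by metis
  obtain C where C: "\<And>m j. m \<le> j \<Longrightarrow>
      emeasure lebesgue (\<Union>x\<in>level (cball 0 R) (m + j). sphere x (r x)) \<le> ennreal C * Fav (level (cball 0 R) m)"
    by (rule bound[of "cball 0 R" 1]) (use R(1) in \<open>auto intro!: cball_thick\<close>)
  have cont: "continuous_on F r" for F
    using assms(7) unfolding gderiv_def by (intro continuous_at_imp_continuous_on ballI has_derivative_continuous) blast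
  have pos: "0 < r x" for x using assms(1) assms(5)[of x] by auto
  have meas: "(\<Union>x\<in>F. sphere x (r x)) \<in> sets lebesgue" if "compact F" for F
    using compact_Union_sphere[OF that cont pos] by (simp add: compact_imp_closed)
  \<comment> \<open>\<open>E\<close> lies in every level of the disc, in particular in level
    \<open>m + m\<close>; \<open>C\<close> does not depend on \<open>m\<close>, so the bound tends
    to 0.\<close>
  have le: "emeasure lebesgue (\<Union>x\<in>E. sphere x (r x)) \<le> ennreal C * Fav (level (cball 0 R) m)" for m
  proof -
    have "E \<subseteq> level (cball 0 R) (m + m)" using level_mono[OF R(2), of "m + m"] level_fixed[OF assms(13)] by simp
    then have "emeasure lebesgue (\<Union>x\<in>E. sphere x (r x)) \<le> emeasure lebesgue (\<Union>x\<in>level (cball 0 R) (m + m). sphere x (r x))"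
      by (intro emeasure_mono meas compact_level) auto
    also have "\<dots> \<le> ennreal C * Fav (level (cball 0 R) m)" by (rule C) simp
    finally show ?thesis .
  qed
  have "(\<lambda>m. ennreal C * Fav (level (cball 0 R) m)) \<longlonglongrightarrow> ennreal C * 0"
    using Fav_level_cball_tendsto_0[OF R(2,3)] by (intro ennreal_tendsto_cmult) auto
  then have "emeasure lebesgue (\<Union>x\<in>E. sphere x (r x)) \<le> ennreal C * 0"
    by (rule LIMSEQ_le_const) (use le in auto)
  then show "(\<Union>x\<in>E. sphere x (r x)) \<in> null_sets lebesgue"
    using meas[OF assms(12)] by (simp add: null_sets_def)
qed

end
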